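(* Suppose $X$ is a doubling nondegenerate metric measure space. (1) Let $0<p_0<p_1\le\infty$, $q\in(0,\infty]$ and $s_0>s_1$ real numbers with $s_1-s_0=\delta_{p_0,p_1}$. Then there is a continuous embedding $T^{p_0,q}_{s_0}\hookrightarrow T^{p_1,q}_{s_1}$. (2) Let $p_0\in(0,\infty]$, $q\in(1,\infty)$, $\alpha>0$, and $s_0,s_1\in\mathbb{R}$ with $(s_1+\alpha)-s_0=\delta_{p_0,\infty}$. Then there is a continuous embedding $T^{p_0,q}_{s_0}\hookrightarrow T^{\infty,q}_{s_1;\alpha}$.
   Context: $(X,d,\mu)$ metric space with Borel measure, nondegenerate ($0<V(x,r):=\mu(B(x,r))<\infty$) and doubling ($V(x,2r)\le CV(x,r)$). $X^+:=X\times(0,\infty)$ with measure $d\mu\,dt/t$. $\Gamma(x):=\{(y,t):d(x,y)<t\}$; $T(B):=\{(y,t):B(y,t)\subset B\}$ for a ball $B$. For $q<\infty$, $\mathcal{A}^qf(x):=(\iint_{\Gamma(x)}|f|^q\frac{d\mu(y)}{V(y,t)}\frac{dt}{t})^{1/q}$; $\mathcal{A}^\infty f(x):=\operatorname{ess\,sup}_{\Gamma(x)}|f|$. $(V^sf)(y,t):=V(y,t)^sf(y,t)$. For $p\in(0,\infty)$, $q\in(0,\infty]$: $\|f\|_{T^{p,q}_s}:=\|\mathcal{A}^q(V^{-s}f)\|_{L^p(X)}$. For $r\in(0,\infty]$, $\alpha\in\mathbb{R}$: $\|f\|_{T^{\infty,r}_{s;\alpha}}:=\sup_B\mu(B)^{-\alpha-1/r}\|V^{-s}f\|_{L^r(T(B),d\mu\,dt/t)}$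 (supremum over balls, $1/\infty:=0$), and $T^{\infty,r}_s:=T^{\infty,r}_{s;0}$ (so $\|f\|_{T^{\infty,\infty}_s}=\|V^{-s}f\|_{L^\infty(X^+)}$). $\delta_{p,q}:=1/q-1/p$. *)

theory Defs
  imports "HOL-Analysis.Analysis"
begin

text \<open>Exponents p, q range over (0,\<infinity>] and are represented as extended reals.
  inv_exp p is 1/p with the convention 1/\<infinity> = 0.\<close>

definition inv_exp :: "ereal \<Rightarrow> real" where
  "inv_exp p = (if p = \<infinity> then 0 else 1 / real_of_ereal p)"

definition delta_exp :: "ereal \<Rightarrow> ereal \<Rightarrow> real" where
  "delta_exp p q = inv_exp q - inv_exp p"

text \<open>Real power of an extended nonnegative real, for positive exponents a.\<close>
definition epowr :: "ennreal \<Rightarrow> real \<Rightarrow> ennreal" where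
  "epowr x a = (if x = top then top else ennreal (enn2real x powr a))"

definition doubling_mms :: "'a::metric_space measure \<Rightarrow> bool" where
  "doubling_mms M \<longleftrightarrow> sets M = sets borel \<and>
     (\<forall>x r. r > 0 \<longrightarrow> 0 < emeasure M (ball x r) \<and> emeasure M (ball x r) < \<infinity>) \<and>
     (\<exists>C. \<forall>x r. r > 0 \<longrightarrow> measure M (ball x (2 * r)) \<le> C * measure M (ball x r))"

definition Vol :: "'a::metric_space measure \<Rightarrow> 'a \<Rightarrow> real \<Rightarrow> real" where
  "Vol M x r = measure M (ball x r)"

definition dtt :: "real measure" where
  "dtt = density (restrict_space lborel {0<..}) (\<lambda>t. ennreal (1 / t))"

definition Xplus :: "'a::metric_space measure \<Rightarrow> ('a \<times> real) measure" where
  "Xplus M = M \<Otimes>\<^sub>M dtt"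

definition cone :: "'a::metric_space \<Rightarrow> ('a \<times> real) set" where
  "cone x = {(y, t). 0 < t \<and> dist x y < t}"

definition tent :: "'a::metric_space set \<Rightarrow> ('a \<times> real) set" where
  "tent B = {(y, t). 0 < t \<and> ball y t \<subseteq> B}"

definition ess_sup_on :: "'b measure \<Rightarrow> 'b set \<Rightarrow> ('b \<Rightarrow> ennreal) \<Rightarrow> ennreal" where
  "ess_sup_on N S g = Inf {c. AE z in N. z \<in> S \<longrightarrow> g z \<le> c}"

definition Vf :: "'a::metric_space measure \<Rightarrow> real \<Rightarrow> ('a \<times> real \<Rightarrow> real) \<Rightarrow> 'a \<times> real \<Rightarrow> real" where
  "Vf M s f z = Vol M (fst z) (snd z) powr (- s) * \<bar>f z\<bar>"

definition area :: "'a::metric_space measure \<Rightarrow> ereal \<Rightarrow> real \<Rightarrow> ('a \<times> real \<Rightarrow> real) \<Rightarrow> 'a \<Rightarrow> ennreal" where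
  "area M q s f x =
     (if q = \<infinity> then ess_sup_on (Xplus M) (cone x) (\<lambda>z. ennreal (Vf M s f z))
      else epowr (\<integral>\<^sup>+ z. indicator (cone x) z *
                 ennreal (Vf M s f z powr real_of_ereal q / Vol M (fst z) (snd z)) \<partial>Xplus M)
                 (1 / real_of_ereal q))"

definition tent_Lnorm :: "'a::metric_space measure \<Rightarrow> ereal \<Rightarrow> real \<Rightarrow> ('a \<times> real \<Rightarrow> real) \<Rightarrow> 'a set \<Rightarrow> ennreal" where
  "tent_Lnorm M r s f B =
     (if r = \<infinity> then ess_sup_on (Xplus M) (tent B) (\<lambda>z. ennreal (Vf M s f z))
      else epowr (\<integral>\<^sup>+ z. indicator (tent B) z * ennreal (Vf M s f z powr real_of_ereal r) \<partial>Xplus M)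
                 (1 / real_of_ereal r))"

definition tent_inf_norm :: "'a::metric_space measure \<Rightarrow> ereal \<Rightarrow> real \<Rightarrow> real \<Rightarrow> ('a \<times> real \<Rightarrow> real) \<Rightarrow> ennreal" where
  "tent_inf_norm M r s \<alpha> f =
     (SUP B \<in> {ball c \<rho> | c \<rho>. 0 < \<rho>}.
        ennreal (measure M B powr (- \<alpha> - inv_exp r)) * tent_Lnorm M r s f B)"

definition tent_norm :: "'a::metric_space measure \<Rightarrow> ereal \<Rightarrow> ereal \<Rightarrow> real \<Rightarrow> ('a \<times> real \<Rightarrow> real) \<Rightarrow> ennreal" where
  "tent_norm M p q s f =
     (if p = \<infinity> then tent_inf_norm M q s 0 f
      else epowr (\<integral>\<^sup>+ x. epowr (area M q s f x) (real_of_ereal p) \<partial>M) (1 / real_of_ereal p))"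

end

theory Submission
  imports Defs
begin

text \<open>
  For finite q put \<open>k = |V\<^sup>-\<^sup>s f|\<^sup>q\<close> and let \<open>F\<close> be the \<open>q\<close>-th power of the area
  function of \<open>f\<close>, so that only the ratio \<open>p = p0 / q\<close> matters. If \<open>I\<close> is the integral of
  \<open>F\<^sup>p\<close>, Markov's inequality gives \<open>F\<^sup>p < 2 I / V(y,t)\<close> on half of the ball \<open>B(y,t)\<close>,
  hence \<open>V(y,t)\<close> to the power \<open>1/p\<close> is controlled by \<open>I\<close> to the power \<open>1/p\<close> times the
  average of \<open>1 / F\<close> over \<open>B(y,t)\<close>. Integrating against \<open>k\<close> over points whose balls lie in a
  set \<open>U\<close> and applying Tonelli, the factors \<open>1 / F\<close> and \<open>F\<close> cancel, and a Carleson-type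
  bound by \<open>\<mu>(U)\<close> remains. With \<open>U\<close> a ball this is the embedding into \<open>p1 = \<infinity>\<close>. For
  \<open>p1 < \<infinity>\<close> one splits the cone at \<open>x\<close> according to the size of \<open>V(y,t)\<close>: by doubling, the
  balls of measure between \<open>v\<close> and \<open>2v\<close> lie in a union of balls around \<open>x\<close> of measure
  comparable to \<open>v\<close>, and summing over dyadic \<open>v\<close> gives a Hedberg-type pointwise bound for the
  new area function. For \<open>q = \<infinity>\<close> one uses instead that \<open>|f(y,t)|\<close> is at most \<open>A\<^sup>\<infinity> f\<close>
  at almost every point of \<open>B(y,t)\<close>.
\<close>

subsection \<open>Powers of extended nonnegative reals, essential suprema\<close>

lemma epowr_0 [simp]: "epowr 0 a = 0"
  by (simp add: epowr_def)

lemma epowr_top [simp]: "epowr top a = top"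
  by (simp add: epowr_def)

lemma epowr_ennreal: "0 \<le> x \<Longrightarrow> epowr (ennreal x) a = ennreal (x powr a)"
  by (simp add: epowr_def)

lemma epowr_mono: "x \<le> y \<Longrightarrow> 0 < a \<Longrightarrow> epowr x a \<le> epowr y a"
  by (cases x; cases y) (auto simp: epowr_ennreal intro!: ennreal_leI powr_mono2 simp: top_unique)

lemma epowr_mult: "0 < a \<Longrightarrow> epowr (x * y) a = epowr x a * epowr y a"
proof (cases "x = 0 \<or> y = 0")
  case False
  assume a: "0 < a"
  show ?thesis
  proof (cases x; cases y)
    fix r s assume "x = ennreal r" "0 \<le> r" "y = ennreal s" "0 \<le> s"
    then show ?thesis by (simp add: epowr_ennreal powr_mult flip: ennreal_mult)
  qed (use False in \<open>auto simp: epowr_ennreal ennreal_mult_top ennreal_top_mult ennreal_mult_eq_top_iff\<close>)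
qed auto

text \<open>Positive exponents keep \<open>top\<close> and 0 fixed, so powers compose with no case
  distinction; this lets all norms be handled in \<open>ennreal\<close>.\<close>

lemma epowr_epowr: "0 < a \<Longrightarrow> 0 < b \<Longrightarrow> epowr (epowr x a) b = epowr x (a * b)"
  by (cases x) (auto simp: epowr_ennreal powr_powr)

lemma epowr_1 [simp]: "epowr x 1 = x"
  by (cases x) (auto simp: epowr_ennreal)

lemma epowr_cancel: "0 < p \<Longrightarrow> epowr (epowr x p) (1 / p) = x"
  by (simp add: epowr_epowr)

lemma measurable_epowr [measurable (raw)]:
  assumes [measurable]: "f \<in> borel_measurable N"
  shows "(\<lambda>x. epowr (f x) a) \<in> borel_measurable N"
  unfolding epowr_def by measurable

text \<open>The essential supremum is itself an essential bound: the infimum is already reached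
  along a sequence of admissible bounds, and countably many null sets have a null union.\<close>

lemma ess_sup_on_le_iff:
  "ess_sup_on N S g \<le> c \<longleftrightarrow> (AE z in N. z \<in> S \<longrightarrow> g z \<le> c)"
proof
  assume "AE z in N. z \<in> S \<longrightarrow> g z \<le> c"
  then show "ess_sup_on N S g \<le> c"
    unfolding ess_sup_on_def by (auto intro: Inf_lower)
next
  assume *: "ess_sup_on N S g \<le> c"
  have "AE z in N. z \<in> S \<longrightarrow> g z \<le> ess_sup_on N S g"
  proof -
    let ?A = "{c. AE z in N. z \<in> S \<longrightarrow> g z \<le> c}"
    have "top \<in> ?A" by simp
    then have "?A \<noteq> {}" by blast
    then obtain u where u: "range u \<subseteq> ?A" "Inf ?A = (INF n::nat. u n)"
      using ennreal_Inf_countable_INF[of ?A] by metis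
    then have "AE z in N. \<forall>n. z \<in> S \<longrightarrow> g z \<le> u n"
      by (subst AE_all_countable) auto
    then show ?thesis
      unfolding ess_sup_on_def u(2) by eventually_elim (auto intro: INF_greatest)
  qed
  then show "AE z in N. z \<in> S \<longrightarrow> g z \<le> c"
    by eventually_elim (use * in auto)
qed

section \<open>Sigma-finite measures and auxiliary integral inequalities\<close>

lemma sigma_finite_dtt: "sigma_finite_measure dtt"
proof -
  have s: "sigma_finite_measure (restrict_space lborel {0::real<..})"
    by (rule sigma_finite_measure_restrict_space) (auto intro: lborel.sigma_finite_measure_axioms)
  show ?thesis
    unfolding dtt_def
    by (subst sigma_finite_measure.sigma_finite_iff_density_finite[OF s])
       (auto simp: sets_restrict_space intro!: measurable_restrict_space1)
qed

lemma space_dtt: "space dtt = {0<..}"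
  by (simp add: dtt_def space_restrict_space)

lemma measurable_id_dtt [measurable]: "(\<lambda>t. t) \<in> borel_measurable dtt"
  unfolding dtt_def by (auto intro!: measurable_restrict_space1)

text \<open>Inside a piece \<open>E n\<close> of finite measure the finite sums of the measures of
  \<open>E n \<inter> A i\<close> are bounded, so only countably many are nonzero. Each
  \<open>A i\<close> has positive measure in some \<open>E n\<close>.\<close>

lemma (in sigma_finite_measure) countable_disjoint_pos_measure:
  assumes "disjoint_family_on A I" and sets: "\<And>i. i \<in> I \<Longrightarrow> A i \<in> sets M"
    and pos: "\<And>i. i \<in> I \<Longrightarrow> 0 < emeasure M (A i)"
  shows "countable I"
proof -
  obtain E :: "nat \<Rightarrow> 'a set" where E: "range E \<subseteq> sets M" "(\<Union>i. E i) = space M"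
      "\<And>i. emeasure M (E i) \<noteq> \<infinity>"
    using sigma_finite by metis
  have [measurable]: "E n \<in> sets M" for n using E(1) by auto
  have fin: "emeasure M (E n \<inter> B) < \<infinity>" if "B \<in> sets M" for n B
    using E(3)[of n] emeasure_mono[of "E n \<inter> B" "E n" M] E(1)
    by (auto simp: less_top[symmetric] top_unique)
  have "countable {i\<in>I. measure M (E n \<inter> A i) \<noteq> 0}" for n
  proof (rule summable_countable_real, rule nonneg_bdd_above_summable_on)
    have "sum (\<lambda>i. measure M (E n \<inter> A i)) F \<le> measure M (E n)" if F: "F \<subseteq> I" "finite F" for F
    proof -
      have "sum (\<lambda>i. measure M (E n \<inter> A i)) F = measure M (\<Union>i\<in>F. E n \<inter> A i)"
        using F assms fin
        by (subst measure_finite_Union)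
           (auto simp: less_top intro: disjoint_family_on_bisimulation[OF disjoint_family_on_mono[OF F(1) assms(1)]])
      also have "\<dots> \<le> measure M (E n)"
        using E(3)[of n] F sets
        by (intro measure_mono_fmeasurable fmeasurableI sets.finite_UN sets.Int) (auto simp: less_top)
      finally show ?thesis .
    qed
    then show "bdd_above (sum (\<lambda>i. measure M (E n \<inter> A i)) ` {F. F \<subseteq> I \<and> finite F})"
      by (intro bdd_aboveI[of _ "measure M (E n)"]) auto
  qed simp
  moreover have "I \<subseteq> (\<Union>n. {i\<in>I. measure M (E n \<inter> A i) \<noteq> 0})"
  proof
    fix i assume i: "i \<in> I"
    have "\<exists>n. emeasure M (E n \<inter> A i) \<noteq> 0"
    proof (rule ccontr)
      assume "\<not> ?thesis"
      then have "emeasure M (\<Union>n. E n \<inter> A i) = 0"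
        using sets[OF i] by (intro emeasure_UN_eq_0) auto
      moreover have "(\<Union>n. E n \<inter> A i) = A i"
        using E(2) sets.sets_into_space[OF sets[OF i]] by auto
      ultimately show False using pos[OF i] by simp
    qed
    then show "i \<in> (\<Union>n. {i\<in>I. measure M (E n \<inter> A i) \<noteq> 0})"
      using i fin[OF sets[OF i]] by (auto simp: measure_def enn2real_eq_0_iff less_top)
  qed
  ultimately show ?thesis by (meson countable_UN countable_subset countableI_type)
qed

text \<open>Reduces an estimate by a power of \<open>X\<close> to real upper bounds
  \<open>I > 0\<close>, so that later arguments may divide by \<open>I\<close>. For
  \<open>X = 0\<close> every such \<open>I\<close> is admissible and the bound can be made
  arbitrarily small.\<close>

lemma le_epowr_of_bound:
  fixes X Y :: ennreal
  assumes D: "0 < D" and e: "0 < e"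
    and bound: "\<And>I::real. 0 < I \<Longrightarrow> X \<le> ennreal I \<Longrightarrow> Y \<le> ennreal (D * I powr e)"
  shows "Y \<le> ennreal D * epowr X e"
proof (cases X)
  case (real a)
  show ?thesis
  proof (cases "a = 0")
    case True
    have *: "Y \<le> 0 + ennreal \<epsilon>" if "0 < \<epsilon>" for \<epsilon>
    proof -
      \<comment> \<open>This choice of \<open>I\<close> solves D * I^e = \<epsilon>.\<close>
      have "D * ((\<epsilon> / D) powr (1 / e)) powr e = \<epsilon>"
        using D e that by (simp add: powr_powr)
      then show ?thesis
        using bound[of "(\<epsilon> / D) powr (1 / e)"] D that True real by simp
    qed
    have "Y \<le> 0" by (rule ennreal_le_epsilon) (rule *)
    then show ?thesis by simp
  next
    case False
    then show ?thesis
      using bound[of a] real D by (simp add: epowr_ennreal ennreal_mult)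
  qed
qed (use D in \<open>simp add: ennreal_mult_top\<close>)

text \<open>Stated for arbitrary \<open>f\<close>, to serve for integrals over tents whose
  measurability is not established. If a simple function \<open>g\<close> lies below c * f, then g /
  c is a simple function below \<open>f\<close>.\<close>

lemma nn_integral_cmult_le:
  assumes c: "0 < c"
  shows "(\<integral>\<^sup>+x. ennreal c * f x \<partial>N) \<le> ennreal c * (\<integral>\<^sup>+x. f x \<partial>N)"
  unfolding nn_integral_def[of N "\<lambda>x. ennreal c * f x"]
proof (intro SUP_least)
  fix g assume "g \<in> {g. simple_function N g \<and> g \<le> (\<lambda>x. ennreal c * f x)}"
  then have g: "simple_function N g" "\<And>x. g x \<le> ennreal c * f x" by (auto simp: le_fun_def)
  have inv: "ennreal c * ennreal (1 / c) = 1" using c by (simp flip: ennreal_mult)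
  have "integral\<^sup>S N g = (\<integral>\<^sup>+x. ennreal c * (ennreal (1 / c) * g x) \<partial>N)"
    using g(1) inv by (simp add: nn_integral_eq_simple_integral flip: mult.assoc)
  also have "\<dots> = ennreal c * (\<integral>\<^sup>+x. ennreal (1 / c) * g x \<partial>N)"
    using g(1) by (intro nn_integral_cmult) (auto dest: borel_measurable_simple_function)
  also have "\<dots> \<le> ennreal c * (\<integral>\<^sup>+x. f x \<partial>N)"
  proof (intro mult_left_mono nn_integral_mono)
    fix x
    have "ennreal (1 / c) * g x \<le> ennreal (1 / c) * (ennreal c * f x)"
      using g(2) by (rule mult_left_mono) simp
    then show "ennreal (1 / c) * g x \<le> f x"
      using inv by (simp add: mult.commute flip: mult.assoc)
  qed simp
  finally show "integral\<^sup>S N g \<le> ennreal c * (\<integral>\<^sup>+x. f x \<partial>N)" .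
qed

subsection \<open>Separability and measurability\<close>

locale doubling_space =
  fixes M :: "'a::metric_space measure"
  assumes doubling: "doubling_mms M"
begin

abbreviation "\<nu> \<equiv> Xplus M"

abbreviation "V \<equiv> (\<lambda>z. Vol M (fst z) (snd z))"

lemma sets_M [simp, measurable_cong]: "sets M = sets borel"
  using doubling by (simp add: doubling_mms_def)

lemma space_M [simp]: "space M = UNIV"
  using sets_eq_imp_space_eq[OF sets_M] by simp

lemma emeasure_ball_pos: "0 < r \<Longrightarrow> 0 < emeasure M (ball x r)"
  and emeasure_ball_finite: "emeasure M (ball x r) < \<infinity>"
  using doubling by (auto simp: doubling_mms_def) (metis ball_empty emeasure_empty ennreal_zero_less_top linorder_not_less)

lemma emeasure_ball: "emeasure M (ball x r) = ennreal (Vol M x r)"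
  unfolding Vol_def using emeasure_ball_finite[of x r] by (intro emeasure_eq_ennreal_measure) auto

lemma Vol_nonneg [simp]: "0 \<le> Vol M x r"
  by (simp add: Vol_def)

lemma Vol_pos: "0 < r \<Longrightarrow> 0 < Vol M x r"
  using emeasure_ball_pos[of r x] by (simp add: emeasure_ball)

lemma Vol_doubling: "\<exists>C>0. \<forall>x r. 0 < r \<longrightarrow> Vol M x (2 * r) \<le> C * Vol M x r"
proof -
  obtain C where C: "\<And>x r. 0 < r \<Longrightarrow> Vol M x (2 * r) \<le> C * Vol M x r"
    using doubling by (auto simp: doubling_mms_def Vol_def)
  \<comment> \<open>Taking the maximum with 1 makes the doubling constant positive.\<close>
  have "Vol M x (2 * r) \<le> max C 1 * Vol M x r" if "0 < r" for x r
    using C[OF that, of x] mult_right_mono[of C "max C 1" "Vol M x r"] by simp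
  then show ?thesis by (intro exI[of _ "max C 1"]) auto
qed

sublocale sigma_finite_measure M
proof
  \<comment> \<open>\<open>undefined\<close> is just some centre; the balls of natural radius around
    it exhaust the space.\<close>
  let ?A = "range (\<lambda>n. ball (undefined::'a) (real n))"
  have "\<Union>?A = UNIV"
    by (auto simp: reals_Archimedean2)
  then show "\<exists>A. countable A \<and> A \<subseteq> sets M \<and> \<Union>A = space M \<and> (\<forall>a\<in>A. emeasure M a \<noteq> \<infinity>)"
    using emeasure_ball_finite by (intro exI[of _ ?A]) (auto simp: less_top)
qed

sublocale dtt: sigma_finite_measure dtt
  by (rule sigma_finite_dtt)

sublocale base: pair_sigma_finite M dtt ..

lemma sigma_finite_Xplus: "sigma_finite_measure \<nu>"
  unfolding Xplus_def by (rule base.sigma_finite_measure_axioms)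

sublocale Xp: sigma_finite_measure "\<nu>"
  by (rule sigma_finite_Xplus)

sublocale P: pair_sigma_finite M "\<nu>" ..

text \<open>The balls of radius e/2 around the points are disjoint and of positive measure, and a
  sigma-finite measure allows only countably many of those.\<close>

lemma countable_separated:
  fixes A :: "'a set"
  assumes e: "0 < e" and A: "\<And>x y. x \<in> A \<Longrightarrow> y \<in> A \<Longrightarrow> x \<noteq> y \<Longrightarrow> e \<le> dist x y"
  shows "countable A"
proof -
  have "ball x (e/2) \<inter> ball y (e/2) = {}" if "x \<in> A" "y \<in> A" "x \<noteq> y" for x y
    using A[OF that] dist_triangle_half_l[of x _ e y] by (meson disjoint_iff mem_ball not_less)
  then have "disjoint_family_on (\<lambda>x. ball x (e/2)) A"
    by (simp add: disjoint_family_on_def)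
  then show ?thesis
    by (rule countable_disjoint_pos_measure) (use e emeasure_ball_pos in auto)
qed

text \<open>A maximal e-separated set exists by Zorn, is countable, and is e-dense, since a point
  far from all of it could be added. The union over e = 1/(n+1) is a countable dense set.\<close>

lemma separable: obtains D :: "'a set" where "countable D" "\<And>x e. 0 < e \<Longrightarrow> \<exists>d\<in>D. dist x d < e"
proof -
  have "\<exists>A::'a set. countable A \<and> (\<forall>x. \<exists>d\<in>A. dist x d < e)" if e: "0 < e" for e
  proof -
    define sep where "sep = {A::'a set. \<forall>x\<in>A. \<forall>y\<in>A. x \<noteq> y \<longrightarrow> e \<le> dist x y}"
    have "\<exists>A\<in>sep. \<forall>B\<in>sep. A \<subseteq> B \<longrightarrow> B = A"
    proof (rule subset_Zorn')
      fix C assume C: "subset.chain sep C"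
      show "\<Union>C \<in> sep"
        unfolding sep_def
      proof safe
        fix x y S T assume xy: "x \<in> S" "S \<in> C" "y \<in> T" "T \<in> C" "x \<noteq> y"
        then have "S \<subseteq> T \<or> T \<subseteq> S" using C by (auto simp: subset_chain_def)
        moreover have "S \<in> sep" "T \<in> sep" using C xy by (auto simp: subset_chain_def)
        ultimately show "e \<le> dist x y" using xy by (auto simp: sep_def)
      qed
    qed
    then obtain A where A: "A \<in> sep" "\<And>B. B \<in> sep \<Longrightarrow> A \<subseteq> B \<Longrightarrow> B = A" by blast
    have "countable A" using A(1) e by (intro countable_separated) (auto simp: sep_def)
    moreover have "\<exists>d\<in>A. dist x d < e" for x
    proof (rule ccontr)
      assume "\<not> ?thesis"
      then have x: "\<And>d. d \<in> A \<Longrightarrow> e \<le> dist x d" by (auto simp: not_less)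
      then have "insert x A \<in> sep" using A(1) by (auto simp: sep_def dist_commute)
      then have "x \<in> A" using A(2) by blast
      then show False using x e by force
    qed
    ultimately show ?thesis by blast
  qed
  then have "\<exists>A::nat \<Rightarrow> 'a set. \<forall>n. countable (A n) \<and> (\<forall>x. \<exists>d\<in>A n. dist x d < inverse (Suc n))"
    by (intro choice) auto
  then obtain A :: "nat \<Rightarrow> 'a set" where
      A: "\<And>n. countable (A n)" "\<And>n x. \<exists>d\<in>A n. dist x d < inverse (Suc n)"
    by blast
  show thesis
  proof
    show "countable (\<Union>n. A n)" using A(1) by auto
    fix x :: 'a and e :: real assume "0 < e"
    then obtain n where n: "inverse (Suc n) < e" using reals_Archimedean by blast
    then show "\<exists>d\<in>(\<Union>n. A n). dist x d < e" using A(2)[of n x] less_trans by blast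
  qed
qed

text \<open>Continuity gives measurability only for the Borel sets of the product, which can exceed
  the product sigma-algebra. Separability writes the distance as a countable infimum of sums, each
  summand depending on one coordinate.\<close>

lemma measurable_dist_M [measurable]: "(\<lambda>z. dist (fst z) (snd z)) \<in> borel_measurable (M \<Otimes>\<^sub>M M)"
proof -
  obtain D :: "'a set" where D: "countable D" "\<And>x e. 0 < e \<Longrightarrow> \<exists>d\<in>D. dist x d < e"
    using separable by blast
  have dist: "dist x y = (INF d\<in>D. dist x d + dist y d)" for x y :: 'a
  proof (rule antisym)
    show "dist x y \<le> (INF d\<in>D. dist x d + dist y d)"
      using D(2)[of 1 x] by (intro cINF_greatest) (auto intro: dist_triangle2)
    show "(INF d\<in>D. dist x d + dist y d) \<le> dist x y"
    proof (rule field_le_epsilon)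
      fix e :: real assume "0 < e"
      then obtain d where d: "d \<in> D" "dist x d < e / 2" using D(2)[of "e/2" x] by auto
      have "(INF d\<in>D. dist x d + dist y d) \<le> dist x d + dist y d"
        using d(1) by (intro cINF_lower bdd_belowI[of _ 0]) auto
      also have "\<dots> \<le> dist x y + e"
        using d(2) dist_triangle[of y d x] by (simp add: dist_commute)
      finally show "(INF d\<in>D. dist x d + dist y d) \<le> dist x y + e" .
    qed
  qed
  have *: "(\<lambda>x. dist x d) \<in> borel_measurable M" for d
    by (subst measurable_cong_sets[OF sets_M refl])
       (intro borel_measurable_continuous_onI continuous_intros)
  have "(\<lambda>z. INF d\<in>D. dist (fst z) d + dist (snd z) d) \<in> borel_measurable (M \<Otimes>\<^sub>M M)"
    using D(1)
    by (intro borel_measurable_cINF_real borel_measurable_add measurable_compose[OF measurable_fst *]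
          measurable_compose[OF measurable_snd *])
  then show ?thesis by (simp flip: dist)
qed

lemma measurable_dist2 [measurable (raw)]:
  assumes [measurable]: "f \<in> measurable N M" "g \<in> measurable N M"
  shows "(\<lambda>z. dist (f z) (g z)) \<in> borel_measurable N"
  using measurable_compose[OF measurable_Pair[OF assms] measurable_dist_M] by simp

lemma measurable_fst_Xplus [measurable]: "fst \<in> measurable \<nu> M"
  and measurable_snd_Xplus [measurable]: "snd \<in> borel_measurable \<nu>"
proof -
  have "(\<lambda>z. snd z) \<in> borel_measurable (M \<Otimes>\<^sub>M dtt)"
    by (rule measurable_compose[OF measurable_snd measurable_id_dtt])
  then show "snd \<in> borel_measurable \<nu>" by (simp add: Xplus_def)
qed (simp add: Xplus_def)

lemma space_Xplus: "space \<nu> = UNIV \<times> {0<..}"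
  by (simp add: Xplus_def space_pair_measure space_dtt)

lemma mem_cone_iff: "z \<in> cone x \<longleftrightarrow> 0 < snd z \<and> dist x (fst z) < snd z"
  by (auto simp: cone_def split: prod.split)

lemma measurable_cone [measurable (raw)]:
  assumes [measurable]: "f \<in> measurable N M" "g \<in> measurable N \<nu>"
  shows "Measurable.pred N (\<lambda>w. g w \<in> cone (f w))"
  unfolding mem_cone_iff
  by measurable

text \<open>V(y,t) is the integral over x of the indicator of (y,t) in the cone at x, hence
  measurable in (y,t) by Tonelli.\<close>

lemma measurable_Vol [measurable]: "V \<in> borel_measurable \<nu>"
proof -
  have "(\<lambda>z. \<integral>\<^sup>+x. indicator {x. z \<in> cone x} x \<partial>M) \<in> borel_measurable \<nu>"
    by (intro borel_measurable_nn_integral) measurable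
  then have "(\<lambda>z. enn2real (\<integral>\<^sup>+x. indicator {x. z \<in> cone x} x \<partial>M)) \<in> borel_measurable \<nu>"
    by measurable
  moreover have "enn2real (\<integral>\<^sup>+x. indicator {x. z \<in> cone x} x \<partial>M) = V z" if "z \<in> space \<nu>" for z
  proof -
    have "{x. z \<in> cone x} = ball (fst z) (snd z)"
      using that by (auto simp: mem_cone_iff space_Xplus dist_commute)
    then show ?thesis by (simp add: Vol_def measure_def)
  qed
  ultimately show ?thesis by (subst (asm) measurable_cong) auto
qed

subsection \<open>The Carleson-type bound\<close>

text \<open>For k = |V^(-s) f|^q this is the q-th power of the area function, the function F of the
  overview.\<close>

definition cone_integral :: "('a \<times> real \<Rightarrow> ennreal) \<Rightarrow> 'a \<Rightarrow> ennreal" where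
  "cone_integral k x = (\<integral>\<^sup>+z. indicator (cone x) z * (k z * ennreal (1 / V z)) \<partial>\<nu>)"

lemma measurable_cone_integral [measurable (raw)]:
  assumes [measurable]: "k \<in> borel_measurable \<nu>"
  shows "cone_integral k \<in> borel_measurable M"
  unfolding cone_integral_def by measurable

text \<open>Tonelli, together with the symmetry that (y,t) lies in the cone at x exactly when x lies
  in B(y,t).\<close>

lemma nn_integral_weight_cone_integral:
  assumes [measurable]: "k \<in> borel_measurable \<nu>" "\<phi> \<in> borel_measurable M"
  shows "(\<integral>\<^sup>+x. \<phi> x * cone_integral k x \<partial>M) =
    (\<integral>\<^sup>+z. k z * ennreal (1 / V z) * (\<integral>\<^sup>+x. indicator (ball (fst z) (snd z)) x * \<phi> x \<partial>M) \<partial>\<nu>)"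
proof -
  have "(\<integral>\<^sup>+x. \<phi> x * cone_integral k x \<partial>M) =
      (\<integral>\<^sup>+x. (\<integral>\<^sup>+z. \<phi> x * (indicator (cone x) z * (k z * ennreal (1 / V z))) \<partial>\<nu>) \<partial>M)"
    unfolding cone_integral_def by (intro nn_integral_cong nn_integral_cmult[symmetric]) measurable
  also have "\<dots> = (\<integral>\<^sup>+z. (\<integral>\<^sup>+x. \<phi> x * (indicator (cone x) z * (k z * ennreal (1 / V z))) \<partial>M) \<partial>\<nu>)"
    by (intro P.Fubini'[symmetric]) measurable
  also have "\<dots> = (\<integral>\<^sup>+z. k z * ennreal (1 / V z) * (\<integral>\<^sup>+x. indicator (ball (fst z) (snd z)) x * \<phi> x \<partial>M) \<partial>\<nu>)"
  proof (intro nn_integral_cong)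
    fix z assume "z \<in> space \<nu>"
    then have eq: "\<phi> x * (indicator (cone x) z * (k z * ennreal (1 / V z))) =
        k z * ennreal (1 / V z) * (indicator (ball (fst z) (snd z)) x * \<phi> x)" for x
      by (auto simp: indicator_def mem_cone_iff space_Xplus dist_commute ac_simps)
    show "(\<integral>\<^sup>+x. \<phi> x * (indicator (cone x) z * (k z * ennreal (1 / V z))) \<partial>M) =
        k z * ennreal (1 / V z) * (\<integral>\<^sup>+x. indicator (ball (fst z) (snd z)) x * \<phi> x \<partial>M)"
      unfolding eq by (intro nn_integral_cmult borel_measurable_times_ennreal borel_measurable_indicator) auto
  qed
  finally show ?thesis .
qed

text \<open>The Markov step. Where F^p is below 2I/V(y,t), 1/F exceeds a fixed constant, and this
  happens on at least half of the ball; the factor 2 on the right comes from that half.\<close>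

lemma Vol_powr_le_average:
  fixes F :: "'a \<Rightarrow> ennreal"
  assumes [measurable]: "F \<in> borel_measurable M" and p: "0 < p" and I: "0 < I"
    and F: "(\<integral>\<^sup>+x. epowr (F x) p \<partial>M) \<le> ennreal I" and r: "0 < r"
  shows "ennreal (Vol M y r powr (1 / p) * Vol M y r) \<le>
    ennreal (2 * (2 * I) powr (1 / p)) * (\<integral>\<^sup>+x. indicator (ball y r) x * inverse (F x) \<partial>M)"
proof -
  define v where "v = Vol M y r"
  have v: "0 < v" using r by (simp add: v_def Vol_pos)
  \<comment> \<open>The threshold for which Markov's inequality gives \<open>H\<close> at most half
    of the measure \<open>v\<close> of the ball.\<close>
  define c where "c = v / (2 * I)"
  have c: "0 < c" using v I by (simp add: c_def)
  let ?b = "ball y r"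
  define L where "L = {x \<in> ?b. ennreal c * epowr (F x) p < 1}"
  define H where "H = {x \<in> ?b. 1 \<le> ennreal c * epowr (F x) p}"
  have [measurable]: "?b \<in> sets M" "Measurable.pred M (\<lambda>x. x \<in> ?b)" by (auto intro!: pred_sets1)
  have [measurable]: "L \<in> sets M" "H \<in> sets M"
    using sets.sets_Collect_conj[of M "\<lambda>x. x \<in> ?b"] unfolding L_def H_def by measurable
  have "emeasure M H \<le> ennreal c * (\<integral>\<^sup>+x. epowr (F x) p * indicator ?b x \<partial>M)"
    unfolding H_def by (intro nn_integral_Markov_inequality) measurable
  also have "\<dots> \<le> ennreal c * ennreal I"
    by (intro mult_left_mono order.trans[OF nn_integral_mono F]) (auto simp: indicator_def)
  also have "\<dots> = ennreal (v / 2)"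
    using I c by (simp add: c_def flip: ennreal_mult)
  finally have H: "emeasure M H \<le> ennreal (v / 2)" .
  have "ennreal v = emeasure M (L \<union> H)"
    unfolding v_def emeasure_ball[symmetric] by (intro arg_cong[where f="emeasure M"]) (auto simp: L_def H_def)
  also have "\<dots> \<le> emeasure M L + emeasure M H"
    by (intro emeasure_subadditive) measurable
  also have "\<dots> \<le> emeasure M L + ennreal (v / 2)"
    using H by (rule add_left_mono)
  finally have "ennreal v - ennreal (v/2) \<le> emeasure M L"
    by (subst ennreal_minus_le_iff) (auto simp: add.commute)
  then have L: "ennreal (v / 2) \<le> emeasure M L"
    using v by (simp add: ennreal_minus)
  \<comment> \<open>On \<open>L\<close> the inequality c * F^p < 1 becomes c^(1/p) * F \<le> 1; the
    value \<open>top\<close> is excluded because c > 0.\<close>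
  have inv: "ennreal (c powr (1 / p)) \<le> inverse (F x)" if "x \<in> L" for x
  proof (cases "F x")
    case (real s)
    then have "c * s powr p < 1"
      using that c by (simp add: L_def epowr_ennreal flip: ennreal_mult)
    then have "(c * s powr p) powr (1 / p) \<le> 1 powr (1 / p)"
      using c p by (intro powr_mono2) auto
    then have le: "c powr (1 / p) * s \<le> 1"
      using c p real by (simp add: powr_mult powr_powr)
    show ?thesis
    proof (cases "s = 0")
      case False
      then show ?thesis
        using le real by (simp add: inverse_ennreal field_simps ennreal_leI)
    qed (simp add: real)
  next
    case top
    then show ?thesis using that c by (simp add: L_def ennreal_mult_top)
  qed
  have "ennreal (v powr (1 / p) * v) = ennreal (2 * (2 * I) powr (1 / p)) * (ennreal (c powr (1 / p)) * ennreal (v / 2))"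
    using I v c by (simp add: c_def powr_divide flip: ennreal_mult)
  also have "\<dots> \<le> ennreal (2 * (2 * I) powr (1 / p)) * (ennreal (c powr (1 / p)) * emeasure M L)"
    using L by (intro mult_left_mono) auto
  also have "ennreal (c powr (1 / p)) * emeasure M L = (\<integral>\<^sup>+x. ennreal (c powr (1 / p)) * indicator L x \<partial>M)"
    by (rule nn_integral_cmult_indicator[symmetric]) measurable
  also have "\<dots> \<le> (\<integral>\<^sup>+x. indicator ?b x * inverse (F x) \<partial>M)"
    using inv by (intro nn_integral_mono) (auto simp: indicator_def L_def)
  finally show ?thesis
    by (simp add: v_def mult_left_mono)
qed

text \<open>The Carleson-type bound. The set \<open>S\<close> may be arbitrary: its indicator
  disappears in a pointwise estimate before Tonelli is applied, and only \<open>U\<close> survives,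
  inside the weight.\<close>

lemma nn_integral_Vol_powr_le:
  assumes [measurable]: "k \<in> borel_measurable \<nu>" "U \<in> sets M" and p: "0 < p" and I: "0 < I"
    and A: "(\<integral>\<^sup>+x. epowr (cone_integral k x) p \<partial>M) \<le> ennreal I"
    and S: "\<And>z. z \<in> S \<Longrightarrow> ball (fst z) (snd z) \<subseteq> U"
  shows "(\<integral>\<^sup>+z. indicator S z * (ennreal (V z powr (1 / p)) * k z) \<partial>\<nu>) \<le>
    ennreal (2 * (2 * I) powr (1 / p)) * emeasure M U"
proof -
  define K where "K = ennreal (2 * (2 * I) powr (1 / p))"
  \<comment> \<open>The weight 1/F cut off to \<open>U\<close>. Over balls contained in
    \<open>U\<close> it has the same average as 1/F.\<close>
  define \<phi> where "\<phi> x = indicator U x * inverse (cone_integral k x)" for x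
  have [measurable]: "\<phi> \<in> borel_measurable M"
    unfolding \<phi>_def by measurable
  have "(\<integral>\<^sup>+z. indicator S z * (ennreal (V z powr (1 / p)) * k z) \<partial>\<nu>) \<le>
      (\<integral>\<^sup>+z. K * (k z * ennreal (1 / V z) * (\<integral>\<^sup>+x. indicator (ball (fst z) (snd z)) x * \<phi> x \<partial>M)) \<partial>\<nu>)"
  proof (intro nn_integral_mono)
    fix z assume z: "z \<in> space \<nu>"
    show "indicator S z * (ennreal (V z powr (1 / p)) * k z) \<le>
        K * (k z * ennreal (1 / V z) * (\<integral>\<^sup>+x. indicator (ball (fst z) (snd z)) x * \<phi> x \<partial>M))"
    proof (cases "z \<in> S")
      case True
      have t: "0 < snd z" using z by (auto simp: space_Xplus)
      have v: "0 < V z" using Vol_pos[OF t] .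
      have "ennreal (V z powr (1 / p)) * k z = k z * ennreal (1 / V z) * ennreal (V z powr (1 / p) * V z)"
        using v by (simp add: mult.assoc mult.commute flip: ennreal_mult)
      also have "\<dots> \<le> k z * ennreal (1 / V z) * (K * (\<integral>\<^sup>+x. indicator (ball (fst z) (snd z)) x * inverse (cone_integral k x) \<partial>M))"
        unfolding K_def by (intro mult_left_mono Vol_powr_le_average p I A t) auto
      also have "(\<integral>\<^sup>+x. indicator (ball (fst z) (snd z)) x * inverse (cone_integral k x) \<partial>M) =
          (\<integral>\<^sup>+x. indicator (ball (fst z) (snd z)) x * \<phi> x \<partial>M)"
        using S[OF True] by (intro nn_integral_cong) (auto simp: \<phi>_def indicator_def)
      finally show ?thesis using True by (simp add: ac_simps)
    qed auto
  qed
  also have "\<dots> = K * (\<integral>\<^sup>+z. k z * ennreal (1 / V z) * (\<integral>\<^sup>+x. indicator (ball (fst z) (snd z)) x * \<phi> x \<partial>M) \<partial>\<nu>)"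
  proof (intro nn_integral_cmult)
    have "(\<lambda>z. k z * ennreal (1 / V z) * (\<integral>\<^sup>+x. indicator {x. z \<in> cone x} x * \<phi> x \<partial>M)) \<in> borel_measurable \<nu>"
      by measurable
    moreover have "{x. z \<in> cone x} = ball (fst z) (snd z)" if "z \<in> space \<nu>" for z
      using that by (auto simp: mem_cone_iff space_Xplus dist_commute)
    ultimately show "(\<lambda>z. k z * ennreal (1 / V z) * (\<integral>\<^sup>+x. indicator (ball (fst z) (snd z)) x * \<phi> x \<partial>M)) \<in> borel_measurable \<nu>"
      by (subst (asm) measurable_cong) auto
  qed
  also have "\<dots> = K * (\<integral>\<^sup>+x. \<phi> x * cone_integral k x \<partial>M)"
    by (subst nn_integral_weight_cone_integral) auto
  also have "\<dots> \<le> K * (\<integral>\<^sup>+x. indicator U x \<partial>M)"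
  proof (intro mult_left_mono nn_integral_mono)
    \<comment> \<open>Only an inequality: the product is 0 when \<open>a\<close> is 0 or
      \<open>top\<close>.\<close>
    have "inverse a * a \<le> 1" for a :: ennreal
    proof (cases a)
      case (real r)
      then show ?thesis
        by (cases "r = 0") (auto simp: inverse_ennreal simp flip: ennreal_mult)
    qed simp
    then show "\<phi> x * cone_integral k x \<le> indicator U x" for x
      by (simp add: \<phi>_def indicator_def)
  qed auto
  also have "(\<integral>\<^sup>+x. indicator U x \<partial>M) = emeasure M U"
    by (rule nn_integral_indicator) measurable
  finally show ?thesis by (simp add: K_def)
qed

text \<open>Stands in for the largest ball around x of measure at most w, which need not exist. The
  admissible balls are nested, and by continuity from below their union still has measure at most
  w.\<close>

lemma exists_nested_ball_union:
  assumes "0 \<le> w"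
  obtains U where "U \<in> sets M" "emeasure M U \<le> ennreal w"
    "\<And>\<rho>. Vol M x \<rho> \<le> w \<Longrightarrow> ball x \<rho> \<subseteq> U"
proof -
  \<comment> \<open>Rational radii make the union countable.\<close>
  define R where "R = {\<rho>\<in>\<rat>. Vol M x \<rho> \<le> w}"
  have cR: "countable R" unfolding R_def by (rule countable_subset[OF _ countable_rat]) auto
  have mono: "Vol M x \<rho> \<le> w" if "\<rho> \<le> \<rho>'" "Vol M x \<rho>' \<le> w" for \<rho> \<rho>'
  proof -
    have "emeasure M (ball x \<rho>) \<le> emeasure M (ball x \<rho>')"
      using that by (intro emeasure_mono) auto
    then show ?thesis using that(2) by (simp add: emeasure_ball)
  qed
  show thesis
  proof
    \<comment> \<open>A finite union of concentric balls is the ball of largest radius.\<close>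
    have bound: "measure M (\<Union>\<rho>\<in>R'. ball x \<rho>) \<le> w" if R': "R' \<subseteq> R" "finite R'" for R'
    proof (cases "R' = {}")
      case False
      have "(\<Union>\<rho>\<in>R'. ball x \<rho>) = ball x (Max R')"
        using R'(2) False Max_gr_iff[OF R'(2) False] by (intro set_eqI) simp
      moreover have "Max R' \<in> R" using Max_in[OF R'(2) False] R'(1) by auto
      ultimately show ?thesis by (simp add: R_def Vol_def)
    qed (use assms in simp)
    have fm: "ball x \<rho> \<in> fmeasurable M" for \<rho>
      using emeasure_ball_finite[of x \<rho>] by (intro fmeasurableI) auto
    show "(\<Union>\<rho>\<in>R. ball x \<rho>) \<in> sets M" by (auto intro!: borel_open)
    show "emeasure M (\<Union>\<rho>\<in>R. ball x \<rho>) \<le> ennreal w"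
      using measure_UN_bound[OF cR fm bound] fmeasurable_UN_bound[OF cR fm bound]
      by (subst emeasure_eq_ennreal_measure) (auto simp: fmeasurable_def intro!: ennreal_leI)
    show "ball x \<rho> \<subseteq> (\<Union>\<rho>\<in>R. ball x \<rho>)" if \<rho>: "Vol M x \<rho> \<le> w" for \<rho>
    proof
      fix y assume "y \<in> ball x \<rho>"
      then obtain q where "q \<in> \<rat>" "dist x y < q" "q < \<rho>" using Rats_dense_in_real by auto
      then show "y \<in> (\<Union>\<rho>\<in>R. ball x \<rho>)" using mono[of q \<rho>] \<rho> by (auto simp: R_def)
    qed
  qed
qed

subsection \<open>Pointwise bounds for finite q\<close>

text \<open>Balls B(y,t) with (y,t) in this shell lie in B(x,2t), which lies in B(y,4t) and so has
  measure at most a multiple of v. They all lie in one set \<open>U\<close> of comparable measure,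
  to which the Carleson-type bound applies.\<close>

lemma cone_integral_dyadic_le:
  obtains D where "0 < D" "\<And>k p I x v. k \<in> borel_measurable \<nu> \<Longrightarrow> 0 < p \<Longrightarrow> 0 < I \<Longrightarrow> 0 < v \<Longrightarrow>
    (\<integral>\<^sup>+x. epowr (cone_integral k x) p \<partial>M) \<le> ennreal I \<Longrightarrow>
    (\<integral>\<^sup>+z. indicator {z \<in> cone x. v < V z \<and> V z \<le> 2 * v} z * (k z * ennreal (1 / V z)) \<partial>\<nu>)
      \<le> ennreal (D * (2 * I) powr (1 / p) * v powr (- 1 / p))"
proof -
  obtain C where C: "0 < C" "\<And>x r. 0 < r \<Longrightarrow> Vol M x (2 * r) \<le> C * Vol M x r"
    using Vol_doubling by blast
  show thesis
  proof (rule that[of "4 * C\<^sup>2"])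
    fix k and p I :: real and x and v :: real
    assume k[measurable]: "k \<in> borel_measurable \<nu>" and p: "0 < p" and I: "0 < I" and v: "0 < v"
      and A: "(\<integral>\<^sup>+x. epowr (cone_integral k x) p \<partial>M) \<le> ennreal I"
    define S where "S = {z \<in> cone x. v < V z \<and> V z \<le> 2 * v}"
    \<comment> \<open>Doubling twice, from radius t to 4t, starting from V(y,t) \<le> 2v.\<close>
    define w where "w = 2 * C\<^sup>2 * v"
    have w: "0 < w" using C v by (simp add: w_def)
    obtain U where U[measurable]: "U \<in> sets M" and U2: "emeasure M U \<le> ennreal w"
        "\<And>\<rho>. Vol M x \<rho> \<le> w \<Longrightarrow> ball x \<rho> \<subseteq> U"
      using exists_nested_ball_union[of w x] w by auto
    have SU: "ball (fst z) (snd z) \<subseteq> U" if "z \<in> S" for z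
    proof -
      obtain y t where z: "z = (y, t)" by (cases z)
      have t: "0 < t" "dist x y < t" and V: "Vol M y t \<le> 2 * v"
        using that by (auto simp: S_def z mem_cone_iff)
      have "emeasure M (ball x (2 * t)) \<le> emeasure M (ball y (4 * t))"
      proof (intro emeasure_mono subsetI)
        fix u assume "u \<in> ball x (2 * t)"
        then show "u \<in> ball y (4 * t)"
          using t dist_triangle[of y u x] by (auto simp: dist_commute)
      qed auto
      then have "Vol M x (2 * t) \<le> Vol M y (2 * (2 * t))" by (simp add: emeasure_ball)
      also have "\<dots> \<le> C * (C * Vol M y t)"
        using C t by (meson order.trans mult_left_mono less_imp_le mult_pos_pos zero_less_numeral)
      also have "\<dots> \<le> C * (C * (2 * v))" using C V by (intro mult_left_mono) auto
      finally have "Vol M x (2 * t) \<le> w" by (simp add: w_def power2_eq_square)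
      moreover have "ball y t \<subseteq> ball x (2 * t)"
      proof
        fix u assume "u \<in> ball y t"
        then show "u \<in> ball x (2 * t)"
          using t dist_triangle[of x u y] by (auto simp: dist_commute)
      qed
      ultimately show ?thesis using U2(2)[of "2 * t"] by (auto simp: z)
    qed
    have "(\<integral>\<^sup>+z. indicator S z * (k z * ennreal (1 / V z)) \<partial>\<nu>) \<le>
        (\<integral>\<^sup>+z. ennreal (v powr (- 1 / p - 1)) * (indicator S z * (ennreal (V z powr (1 / p)) * k z)) \<partial>\<nu>)"
    proof (intro nn_integral_mono)
      fix z
      show "indicator S z * (k z * ennreal (1 / V z)) \<le>
          ennreal (v powr (- 1 / p - 1)) * (indicator S z * (ennreal (V z powr (1 / p)) * k z))"
      proof (cases "z \<in> S")
        case True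
        then have V: "v < V z" by (simp add: S_def)
        \<comment> \<open>On the shell the weight 1/V is traded for V^(1/p), the weight of the
          Carleson-type bound, at the cost of a power of v.\<close>
        have "1 / V z \<le> 1 / v" using V v by (simp add: frac_le)
        also have "\<dots> = v powr (- 1 / p - 1) * v powr (1 / p)"
          using v by (simp add: powr_minus_divide flip: powr_add)
        also have "\<dots> \<le> v powr (- 1 / p - 1) * V z powr (1 / p)"
          using V v p by (intro mult_left_mono powr_mono2) auto
        finally have "ennreal (1 / V z) \<le> ennreal (v powr (- 1 / p - 1)) * ennreal (V z powr (1 / p))"
          by (simp add: ennreal_leI flip: ennreal_mult)
        then have "k z * ennreal (1 / V z) \<le> k z * (ennreal (v powr (- 1 / p - 1)) * ennreal (V z powr (1 / p)))"
          by (rule mult_left_mono) simp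
        then show ?thesis using True by (simp add: ac_simps)
      qed auto
    qed
    also have "\<dots> = ennreal (v powr (- 1 / p - 1)) *
        (\<integral>\<^sup>+z. indicator S z * (ennreal (V z powr (1 / p)) * k z) \<partial>\<nu>)"
      unfolding S_def by (intro nn_integral_cmult) measurable
    also have "\<dots> \<le> ennreal (v powr (- 1 / p - 1)) *
        (ennreal (2 * (2 * I) powr (1 / p)) * ennreal w)"
      by (intro mult_left_mono order.trans[OF nn_integral_Vol_powr_le[OF k U p I A SU]] U2) auto
    also have "\<dots> = ennreal (4 * C\<^sup>2 * (2 * I) powr (1 / p) * (v powr (- 1 / p - 1) * v))"
      using w I v by (simp add: w_def ac_simps flip: ennreal_mult)
    also have "v powr (- 1 / p - 1) * v = v powr (- 1 / p)"
      using v by (simp add: powr_diff)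
    finally show "(\<integral>\<^sup>+z. indicator {z \<in> cone x. v < V z \<and> V z \<le> 2 * v} z * (k z * ennreal (1 / V z)) \<partial>\<nu>)
      \<le> ennreal (4 * C\<^sup>2 * (2 * I) powr (1 / p) * v powr (- 1 / p))"
      by (simp add: S_def)
  qed (use C in simp)
qed

text \<open>Where V \<le> \<tau> the new factor is at most its value at \<tau>. The rest is cut into
  dyadic shells; on the m-th one the growth of V^\<eta> and the decay of the shell bound combine to
  (2^m \<tau>)^(-1/r), a geometric series.\<close>

lemma cone_integral_split_le:
  assumes p: "0 < p" and pr: "p < r"
  obtains D where "0 < D" "\<And>k I x \<tau>. k \<in> borel_measurable \<nu> \<Longrightarrow> 0 < I \<Longrightarrow> 0 < \<tau> \<Longrightarrow>
    (\<integral>\<^sup>+x. epowr (cone_integral k x) p \<partial>M) \<le> ennreal I \<Longrightarrow>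
    cone_integral (\<lambda>z. ennreal (V z powr (1 / p - 1 / r)) * k z) x
      \<le> ennreal (\<tau> powr (1 / p - 1 / r)) * cone_integral k x + ennreal (D * I powr (1 / p) * \<tau> powr (- 1 / r))"
proof -
  define \<eta> where "\<eta> = 1 / p - 1 / r"
  have r: "0 < r" using p pr by simp
  have \<eta>: "0 < \<eta>" using p pr by (simp add: \<eta>_def frac_less2)
  obtain C where C: "0 < C" "\<And>k p I x v. k \<in> borel_measurable \<nu> \<Longrightarrow> 0 < p \<Longrightarrow> 0 < I \<Longrightarrow> 0 < v \<Longrightarrow>
    (\<integral>\<^sup>+x. epowr (cone_integral k x) p \<partial>M) \<le> ennreal I \<Longrightarrow>
    (\<integral>\<^sup>+z. indicator {z \<in> cone x. v < V z \<and> V z \<le> 2 * v} z * (k z * ennreal (1 / V z)) \<partial>\<nu>)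
      \<le> ennreal (C * (2 * I) powr (1 / p) * v powr (- 1 / p))"
    using cone_integral_dyadic_le by blast
  define \<theta> where "\<theta> = 2 powr (- 1 / r)"
  have \<theta>: "0 < \<theta>" "\<theta> < 1" 
    using r powr_less_mono[of "- 1 / r" 0 2] by (auto simp: \<theta>_def)
  \<comment> \<open>The factors come from the upper end of a shell, the shell bound, the 2 in 2I,
    and the sum of the geometric series.\<close>
  define D where "D = 2 powr \<eta> * C * 2 powr (1 / p) * (1 / (1 - \<theta>))"
  show thesis
  proof (rule that[of D, folded \<eta>_def])
    show "0 < D" using C \<theta> by (simp add: D_def)
    fix k and I :: real and x and \<tau> :: real
    assume k[measurable]: "k \<in> borel_measurable \<nu>" and I: "0 < I" and \<tau>: "0 < \<tau>"
      and A: "(\<integral>\<^sup>+x. epowr (cone_integral k x) p \<partial>M) \<le> ennreal I"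
    define S where "S m = {z \<in> cone x. 2 ^ m * \<tau> < V z \<and> V z \<le> 2 * (2 ^ m * \<tau>)}" for m :: nat
    define h where "h z = k z * ennreal (1 / V z)" for z
    have [measurable]: "h \<in> borel_measurable \<nu>" unfolding h_def by measurable
    have S_meas [measurable]: "(\<lambda>z. indicator (S m) z :: ennreal) \<in> borel_measurable \<nu>" for m
      unfolding S_def by measurable
    have "cone_integral (\<lambda>z. ennreal (V z powr \<eta>) * k z) x \<le>
        (\<integral>\<^sup>+z. ennreal (\<tau> powr \<eta>) * (indicator (cone x) z * h z) +
          (\<Sum>m. ennreal ((2 * (2 ^ m * \<tau>)) powr \<eta>) * (indicator (S m) z * h z)) \<partial>\<nu>)"
      unfolding cone_integral_def
    proof (intro nn_integral_mono)
      fix z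
      show "indicator (cone x) z * (ennreal (V z powr \<eta>) * k z * ennreal (1 / V z)) \<le>
          ennreal (\<tau> powr \<eta>) * (indicator (cone x) z * h z) +
          (\<Sum>m. ennreal ((2 * (2 ^ m * \<tau>)) powr \<eta>) * (indicator (S m) z * h z))"
      proof (cases "z \<in> cone x")
        case z: True
        show ?thesis
        proof (cases "V z \<le> \<tau>")
          case True
          then have "ennreal (V z powr \<eta>) * h z \<le> ennreal (\<tau> powr \<eta>) * h z"
            using \<eta> by (intro mult_right_mono ennreal_leI powr_mono2) auto
          then show ?thesis using z
            by (simp add: h_def mult.assoc add_increasing2)
        next
          case False
          have "\<exists>n. V z \<le> 2 ^ n * \<tau>"
          proof -
            obtain n where "V z / \<tau> < 2 ^ n" using real_arch_pow[of 2 "V z / \<tau>"] by auto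
            then show ?thesis using \<tau> by (intro exI[of _ n]) (simp add: field_simps)
          qed
          \<comment> \<open>The least such n is positive because V z > \<tau>; its predecessor is
            the index of the shell containing z.\<close>
          then obtain n where n: "V z \<le> 2 ^ n * \<tau>" "\<And>i. i < n \<Longrightarrow> \<not> V z \<le> 2 ^ i * \<tau>"
            using exists_least_iff[of "\<lambda>n. V z \<le> 2 ^ n * \<tau>"] by blast
          then obtain m where m: "n = Suc m" using False by (cases n) auto
          have Sm: "z \<in> S m" using n z by (auto simp: S_def m not_le)
          have "ennreal (V z powr \<eta>) * h z \<le> ennreal ((2 * (2 ^ m * \<tau>)) powr \<eta>) * (indicator (S m) z * h z)"
            using \<eta> Sm by (auto intro!: mult_right_mono ennreal_leI powr_mono2 simp: S_def)
          also have "\<dots> \<le> (\<Sum>m. ennreal ((2 * (2 ^ m * \<tau>)) powr \<eta>) * (indicator (S m) z * h z))"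
            using sum_le_suminf[of "\<lambda>m. ennreal ((2 * (2 ^ m * \<tau>)) powr \<eta>) * (indicator (S m) z * h z)" "{m}"]
            by simp
          finally show ?thesis using z
            by (simp add: h_def mult.assoc add_increasing)
        qed
      qed auto
    qed
    also have "\<dots> = ennreal (\<tau> powr \<eta>) * cone_integral k x +
        (\<Sum>m. ennreal ((2 * (2 ^ m * \<tau>)) powr \<eta>) * (\<integral>\<^sup>+z. indicator (S m) z * h z \<partial>\<nu>))"
    proof -
      have "(\<integral>\<^sup>+z. ennreal (\<tau> powr \<eta>) * (indicator (cone x) z * h z) \<partial>\<nu>) = ennreal (\<tau> powr \<eta>) * cone_integral k x"
        unfolding cone_integral_def h_def by (intro nn_integral_cmult) measurable
      moreover have "(\<integral>\<^sup>+z. (\<Sum>m. ennreal ((2 * (2 ^ m * \<tau>)) powr \<eta>) * (indicator (S m) z * h z)) \<partial>\<nu>) =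
          (\<Sum>m. ennreal ((2 * (2 ^ m * \<tau>)) powr \<eta>) * (\<integral>\<^sup>+z. indicator (S m) z * h z \<partial>\<nu>))"
        by (subst nn_integral_suminf) (auto intro!: suminf_cong nn_integral_cmult)
      ultimately show ?thesis
        by (subst nn_integral_add) (auto intro!: borel_measurable_suminf_order)
    qed
    also have "(\<Sum>m. ennreal ((2 * (2 ^ m * \<tau>)) powr \<eta>) * (\<integral>\<^sup>+z. indicator (S m) z * h z \<partial>\<nu>)) \<le>
        (\<Sum>m. ennreal (2 powr \<eta> * C * (2 * I) powr (1 / p) * \<tau> powr (- 1 / r) * \<theta> ^ m))"
    proof (intro suminf_le allI)
      fix m :: nat
      have "(2 * (2 ^ m * \<tau>)) powr \<eta> * (2 ^ m * \<tau>) powr (- 1 / p) = 2 powr \<eta> * (2 ^ m * \<tau>) powr (\<eta> - 1 / p)"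
        using \<tau> by (simp add: powr_mult powr_diff powr_minus_divide)
      also have "\<eta> - 1 / p = - 1 / r" by (simp add: \<eta>_def)
      also have "(2 ^ m * \<tau>) powr (- 1 / r) = \<theta> ^ m * \<tau> powr (- 1 / r)"
        using \<tau> by (simp add: powr_mult \<theta>_def powr_powr mult.commute flip: powr_realpow)
      finally have eq: "(2 * (2 ^ m * \<tau>)) powr \<eta> * (2 ^ m * \<tau>) powr (- 1 / p) =
          2 powr \<eta> * (\<theta> ^ m * \<tau> powr (- 1 / r))" .
      have "ennreal ((2 * (2 ^ m * \<tau>)) powr \<eta>) * (\<integral>\<^sup>+z. indicator (S m) z * h z \<partial>\<nu>) \<le>
        ennreal ((2 * (2 ^ m * \<tau>)) powr \<eta>) * ennreal (C * (2 * I) powr (1 / p) * (2 ^ m * \<tau>) powr (- 1 / p))"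
        unfolding S_def h_def using \<tau> by (intro mult_left_mono C(2)[OF k p I _ A]) auto
      also have "\<dots> = ennreal (C * (2 * I) powr (1 / p) * ((2 * (2 ^ m * \<tau>)) powr \<eta> * (2 ^ m * \<tau>) powr (- 1 / p)))"
        using C(1) by (simp add: ac_simps flip: ennreal_mult)
      also have "\<dots> = ennreal (2 powr \<eta> * C * (2 * I) powr (1 / p) * \<tau> powr (- 1 / r) * \<theta> ^ m)"
        unfolding eq by (simp add: ac_simps)
      finally show "ennreal ((2 * (2 ^ m * \<tau>)) powr \<eta>) * (\<integral>\<^sup>+z. indicator (S m) z * h z \<partial>\<nu>) \<le> \<dots>" .
    qed auto
    also have "\<dots> = ennreal (2 powr \<eta> * C * (2 * I) powr (1 / p) * \<tau> powr (- 1 / r) * (1 / (1 - \<theta>)))"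
      using \<theta> C(1) by (subst suminf_ennreal2) (auto intro!: summable_mult simp: suminf_mult suminf_geometric)
    also have "2 powr \<eta> * C * (2 * I) powr (1 / p) * \<tau> powr (- 1 / r) * (1 / (1 - \<theta>)) =
        D * I powr (1 / p) * \<tau> powr (- 1 / r)"
      using I by (simp add: D_def powr_mult)
    finally show "cone_integral (\<lambda>z. ennreal (V z powr \<eta>) * k z) x
      \<le> ennreal (\<tau> powr \<eta>) * cone_integral k x + ennreal (D * I powr (1 / p) * \<tau> powr (- 1 / r))"
      by (simp add: add_left_mono)
  qed
qed

text \<open>The Hedberg-type bound, from choosing the splitting level \<tau> so that both terms
  become multiples of I^\<eta> * a^(p/r), where a is the old cone integral at x.\<close>

lemma cone_integral_Vol_powr_pointwise:
  assumes p: "0 < p" and pr: "p < r"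
  obtains D where "0 < D" "\<And>k I x. k \<in> borel_measurable \<nu> \<Longrightarrow> 0 < I \<Longrightarrow>
    (\<integral>\<^sup>+x. epowr (cone_integral k x) p \<partial>M) \<le> ennreal I \<Longrightarrow>
    cone_integral (\<lambda>z. ennreal (V z powr (1 / p - 1 / r)) * k z) x
      \<le> ennreal (D * I powr (1 / p - 1 / r)) * epowr (cone_integral k x) (p / r)"
proof -
  define \<eta> where "\<eta> = 1 / p - 1 / r"
  have r: "0 < r" using p pr by simp
  obtain C where C: "0 < C" "\<And>k I x \<tau>. k \<in> borel_measurable \<nu> \<Longrightarrow> 0 < I \<Longrightarrow> 0 < \<tau> \<Longrightarrow>
    (\<integral>\<^sup>+x. epowr (cone_integral k x) p \<partial>M) \<le> ennreal I \<Longrightarrow>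
    cone_integral (\<lambda>z. ennreal (V z powr \<eta>) * k z) x
      \<le> ennreal (\<tau> powr \<eta>) * cone_integral k x + ennreal (C * I powr (1 / p) * \<tau> powr (- 1 / r))"
    using cone_integral_split_le[OF p pr, folded \<eta>_def] by blast
  show thesis
  proof (rule that[of "1 + C", folded \<eta>_def])
    fix k and I :: real and x
    assume k[measurable]: "k \<in> borel_measurable \<nu>" and I: "0 < I"
      and A: "(\<integral>\<^sup>+x. epowr (cone_integral k x) p \<partial>M) \<le> ennreal I"
    show "cone_integral (\<lambda>z. ennreal (V z powr \<eta>) * k z) x \<le> ennreal ((1 + C) * I powr \<eta>) * epowr (cone_integral k x) (p / r)"
    proof (cases "cone_integral k x")
      case (real a)
      show ?thesis
      proof (cases "a = 0")
        \<comment> \<open>No balancing level exists for a = 0, but then \<open>k\<close> vanishes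
          almost everywhere on the cone, and so does its multiple.\<close>
        case True
        then have "AE z in \<nu>. indicator (cone x) z * (k z * ennreal (1 / V z)) = 0"
          using real unfolding cone_integral_def by (subst nn_integral_0_iff_AE[symmetric]) auto
        then have "AE z in \<nu>. indicator (cone x) z * (ennreal (V z powr \<eta>) * k z * ennreal (1 / V z)) = 0"
          by eventually_elim (auto simp: mult.assoc)
        then have "cone_integral (\<lambda>z. ennreal (V z powr \<eta>) * k z) x = 0"
          unfolding cone_integral_def by (subst nn_integral_0_iff_AE) auto
        then show ?thesis by simp
      next
        case False
        then have a: "0 < a" using real by simp
        \<comment> \<open>The level balancing the two terms of the split.\<close>
        define \<tau> where "\<tau> = I / a powr p"
        have \<tau>: "0 < \<tau>" using a I by (simp add: \<tau>_def)
        have "\<tau> powr \<eta> * a = I powr \<eta> * (a powr 1 / a powr (p * \<eta>))"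
          using a I by (simp add: \<tau>_def powr_divide powr_powr)
        also have "\<dots> = I powr \<eta> * a powr (p / r)"
          using p r unfolding powr_diff[symmetric] by (simp add: \<eta>_def right_diff_distrib)
        finally have 1: "\<tau> powr \<eta> * a = I powr \<eta> * a powr (p / r)" .
        have "I powr (1 / p) * \<tau> powr (- 1 / r) = (I powr (1 / p) * I powr (- 1 / r)) / a powr (p * (- 1 / r))"
          using a I by (simp add: \<tau>_def powr_divide powr_powr)
        also have "\<dots> = I powr \<eta> * a powr (p / r)"
          by (simp add: \<eta>_def powr_minus_divide powr_diff)
        finally have 2: "C * I powr (1 / p) * \<tau> powr (- 1 / r) = C * (I powr \<eta> * a powr (p / r))"
          by (simp add: mult.assoc)
        have "cone_integral (\<lambda>z. ennreal (V z powr \<eta>) * k z) x \<le>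
            ennreal (\<tau> powr \<eta>) * ennreal a + ennreal (C * I powr (1 / p) * \<tau> powr (- 1 / r))"
          using C(2)[OF k I \<tau> A, of x] real by simp
        also have "\<dots> = ennreal (\<tau> powr \<eta> * a + C * I powr (1 / p) * \<tau> powr (- 1 / r))"
          using a C(1) by (simp flip: ennreal_mult ennreal_plus)
        also have "\<tau> powr \<eta> * a + C * I powr (1 / p) * \<tau> powr (- 1 / r) = (1 + C) * I powr \<eta> * a powr (p / r)"
          unfolding 1 2 by (simp add: algebra_simps)
        also have "ennreal \<dots> = ennreal ((1 + C) * I powr \<eta>) * epowr (cone_integral k x) (p / r)"
          using real C(1) by (simp add: epowr_ennreal ennreal_mult)
        finally show ?thesis .
      qed
    next
      case top
      then show ?thesis using C(1) I by (simp add: ennreal_mult_top)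
    qed
  qed (use C in simp)
qed

text \<open>The pointwise bound is raised to the power r and integrated: the cone integral then
  appears to the power p, and I^(\<eta> r) * I = I^(r/p).\<close>

lemma nn_integral_cone_integral_Vol_powr_le:
  assumes p: "0 < p" and pr: "p < r"
  obtains D where "0 < D" "\<And>k. k \<in> borel_measurable \<nu> \<Longrightarrow>
    (\<integral>\<^sup>+x. epowr (cone_integral (\<lambda>z. ennreal (V z powr (1 / p - 1 / r)) * k z) x) r \<partial>M)
      \<le> ennreal D * epowr (\<integral>\<^sup>+x. epowr (cone_integral k x) p \<partial>M) (r / p)"
proof -
  define \<eta> where "\<eta> = 1 / p - 1 / r"
  have r: "0 < r" using p pr by simp
  obtain C where C: "0 < C" "\<And>k I x. k \<in> borel_measurable \<nu> \<Longrightarrow> 0 < I \<Longrightarrow>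
    (\<integral>\<^sup>+x. epowr (cone_integral k x) p \<partial>M) \<le> ennreal I \<Longrightarrow>
    cone_integral (\<lambda>z. ennreal (V z powr \<eta>) * k z) x \<le> ennreal (C * I powr \<eta>) * epowr (cone_integral k x) (p / r)"
    using cone_integral_Vol_powr_pointwise[OF p pr, folded \<eta>_def] by blast
  show thesis
  proof (rule that[of "C powr r", folded \<eta>_def])
    fix k :: "'a \<times> real \<Rightarrow> ennreal" assume k[measurable]: "k \<in> borel_measurable \<nu>"
    show "(\<integral>\<^sup>+x. epowr (cone_integral (\<lambda>z. ennreal (V z powr \<eta>) * k z) x) r \<partial>M)
      \<le> ennreal (C powr r) * epowr (\<integral>\<^sup>+x. epowr (cone_integral k x) p \<partial>M) (r / p)"
    proof (rule le_epowr_of_bound)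
      fix I :: real assume I: "0 < I" and A: "(\<integral>\<^sup>+x. epowr (cone_integral k x) p \<partial>M) \<le> ennreal I"
      have "(\<integral>\<^sup>+x. epowr (cone_integral (\<lambda>z. ennreal (V z powr \<eta>) * k z) x) r \<partial>M) \<le>
          (\<integral>\<^sup>+x. ennreal ((C * I powr \<eta>) powr r) * epowr (cone_integral k x) p \<partial>M)"
      proof (rule nn_integral_mono)
        fix x
        have "epowr (cone_integral (\<lambda>z. ennreal (V z powr \<eta>) * k z) x) r \<le>
            epowr (ennreal (C * I powr \<eta>) * epowr (cone_integral k x) (p / r)) r"
          by (intro epowr_mono C(2) k I A r)
        also have "\<dots> = ennreal ((C * I powr \<eta>) powr r) * epowr (cone_integral k x) p"
          using C(1) p r by (simp add: epowr_mult epowr_epowr epowr_ennreal)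
        finally show "epowr (cone_integral (\<lambda>z. ennreal (V z powr \<eta>) * k z) x) r \<le> \<dots>" .
      qed
      also have "\<dots> = ennreal ((C * I powr \<eta>) powr r) * (\<integral>\<^sup>+x. epowr (cone_integral k x) p \<partial>M)"
        by (intro nn_integral_cmult) measurable
      also have "\<dots> \<le> ennreal ((C * I powr \<eta>) powr r) * ennreal I"
        using A by (intro mult_left_mono) auto
      also have "\<dots> = ennreal (C powr r * (I powr (\<eta> * r) * I powr 1))"
        using C(1) I by (simp add: powr_mult powr_powr mult.assoc flip: ennreal_mult)
      also have "I powr (\<eta> * r) * I powr 1 = I powr (r / p)"
        using r unfolding powr_add[symmetric] by (simp add: \<eta>_def left_diff_distrib)
      finally show "(\<integral>\<^sup>+x. epowr (cone_integral (\<lambda>z. ennreal (V z powr \<eta>) * k z) x) r \<partial>M)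
        \<le> ennreal (C powr r * I powr (r / p))" .
    qed (use C r p in auto)
  qed (use C in simp)
qed

subsection \<open>The case of infinite q\<close>

abbreviation ess_area :: "('a \<times> real \<Rightarrow> ennreal) \<Rightarrow> 'a \<Rightarrow> ennreal" where
  "ess_area g x \<equiv> ess_sup_on \<nu> (cone x) g"

text \<open>The essential supremum at x is at most y exactly when the part of the cone where g > y
  is null, and the measure of that part is measurable in x.\<close>

lemma measurable_ess_area [measurable]:
  assumes [measurable]: "g \<in> borel_measurable \<nu>"
  shows "ess_area g \<in> borel_measurable M"
proof (rule borel_measurableI_greater)
  fix y
  define h where "h x = (\<integral>\<^sup>+z. indicator (cone x) z * indicator {z. y < g z} z \<partial>\<nu>)" for x
  have [measurable]: "h \<in> borel_measurable M"
    unfolding h_def by measurable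
  have "ess_area g x \<le> y \<longleftrightarrow> h x = 0" for x
  proof -
    have "h x = 0 \<longleftrightarrow> (AE z in \<nu>. indicator (cone x) z * indicator {z. y < g z} z = (0::ennreal))"
      unfolding h_def by (rule nn_integral_0_iff_AE) measurable
    also have "\<dots> \<longleftrightarrow> (AE z in \<nu>. z \<in> cone x \<longrightarrow> g z \<le> y)"
      by (intro AE_cong) (auto simp: indicator_def)
    finally show ?thesis by (simp add: ess_sup_on_le_iff)
  qed
  then have "{x \<in> space M. y < ess_area g x} = {x \<in> space M. h x \<noteq> 0}"
    by (auto simp: not_le[symmetric])
  then show "{x \<in> space M. y < ess_area g x} \<in> sets M"
    by simp
qed

text \<open>For each x the inequality holds for almost every z; the exceptional set is jointly
  measurable, so Fubini exchanges the quantifiers.\<close>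

lemma AE_le_ess_area:
  assumes [measurable]: "g \<in> borel_measurable \<nu>"
  shows "AE z in \<nu>. AE x in M. z \<in> cone x \<longrightarrow> g z \<le> ess_area g x"
proof -
  have "AE x in M. AE z in \<nu>. z \<in> cone x \<longrightarrow> g z \<le> ess_area g x"
    by (simp flip: ess_sup_on_le_iff)
  moreover have "{w \<in> space (M \<Otimes>\<^sub>M \<nu>). snd w \<in> cone (fst w) \<longrightarrow> g (snd w) \<le> ess_area g (fst w)}
      \<in> sets (M \<Otimes>\<^sub>M \<nu>)"
    by measurable
  ultimately show ?thesis
    by (subst (asm) P.AE_commute) auto
qed

text \<open>The value g(z) is dominated by the area function at almost every point of the ball of z;
  integrate over that ball.\<close>

lemma AE_Vol_mult_epowr_le:
  assumes g[measurable]: "g \<in> borel_measurable \<nu>" and p: "0 < p"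
  shows "AE z in \<nu>. ennreal (V z) * epowr (g z) p \<le> (\<integral>\<^sup>+x. epowr (ess_area g x) p \<partial>M)"
  using AE_le_ess_area[OF g] AE_space
proof eventually_elim
  fix z assume ae: "AE x in M. z \<in> cone x \<longrightarrow> g z \<le> ess_area g x" and z: "z \<in> space \<nu>"
  let ?b = "ball (fst z) (snd z)"
  have "ennreal (V z) * epowr (g z) p = (\<integral>\<^sup>+x. epowr (g z) p * indicator ?b x \<partial>M)"
    by (subst nn_integral_cmult_indicator) (auto simp: emeasure_ball mult.commute)
  also have "\<dots> \<le> (\<integral>\<^sup>+x. epowr (ess_area g x) p \<partial>M)"
  proof (rule nn_integral_mono_AE)
    show "AE x in M. epowr (g z) p * indicator ?b x \<le> epowr (ess_area g x) p"
      using ae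
      by eventually_elim
         (use z in \<open>auto simp: indicator_def mem_cone_iff space_Xplus dist_commute intro: epowr_mono p\<close>)
  qed
  finally show "ennreal (V z) * epowr (g z) p \<le> (\<integral>\<^sup>+x. epowr (ess_area g x) p \<partial>M)" .
qed

lemma AE_Vol_powr_mult_le:
  assumes g[measurable]: "g \<in> borel_measurable \<nu>" and p: "0 < p"
  shows "AE z in \<nu>. ennreal (V z powr (1 / p)) * g z \<le> epowr (\<integral>\<^sup>+x. epowr (ess_area g x) p \<partial>M) (1 / p)"
  using AE_Vol_mult_epowr_le[OF g p]
proof eventually_elim
  fix z assume "ennreal (V z) * epowr (g z) p \<le> (\<integral>\<^sup>+x. epowr (ess_area g x) p \<partial>M)"
  then have "epowr (ennreal (V z) * epowr (g z) p) (1 / p) \<le> epowr (\<integral>\<^sup>+x. epowr (ess_area g x) p \<partial>M) (1 / p)"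
    using p by (intro epowr_mono) auto
  then show "ennreal (V z powr (1 / p)) * g z \<le> epowr (\<integral>\<^sup>+x. epowr (ess_area g x) p \<partial>M) (1 / p)"
    using p by (simp add: epowr_mult epowr_cancel epowr_ennreal)
qed

text \<open>With \<eta> = 1/p - 1/r one has p\<eta> + p/r = 1, so V^\<eta> g = (V g^p)^\<eta> *
  g^(p/r). The first factor is bounded by the whole integral, the second by the area function at
  x.\<close>

lemma ess_area_Vol_powr_le:
  assumes g[measurable]: "g \<in> borel_measurable \<nu>" and p: "0 < p" and pr: "p < r"
  shows "ess_area (\<lambda>z. ennreal (V z powr (1 / p - 1 / r)) * g z) x \<le>
    epowr (\<integral>\<^sup>+x. epowr (ess_area g x) p \<partial>M) (1 / p - 1 / r) * epowr (ess_area g x) (p / r)"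
proof -
  define \<eta> where "\<eta> = 1 / p - 1 / r"
  have r: "0 < r" using p pr by simp
  have \<eta>: "0 < \<eta>" using p pr by (simp add: \<eta>_def frac_less2)
  have "AE z in \<nu>. z \<in> cone x \<longrightarrow> g z \<le> ess_area g x"
    by (simp flip: ess_sup_on_le_iff)
  with AE_Vol_mult_epowr_le[OF g p]
  have "AE z in \<nu>. z \<in> cone x \<longrightarrow> ennreal (V z powr \<eta>) * g z \<le>
      epowr (\<integral>\<^sup>+x. epowr (ess_area g x) p \<partial>M) \<eta> * epowr (ess_area g x) (p / r)"
  proof eventually_elim
    fix z assume *: "ennreal (V z) * epowr (g z) p \<le> (\<integral>\<^sup>+x. epowr (ess_area g x) p \<partial>M)"
      "z \<in> cone x \<longrightarrow> g z \<le> ess_area g x"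
    have exp: "p * \<eta> + p / r = 1" using p r by (simp add: \<eta>_def right_diff_distrib)
    have "g z = epowr (g z) (p * \<eta>) * epowr (g z) (p / r)"
      using exp by (cases "g z") (auto simp: epowr_ennreal ennreal_mult_top simp flip: ennreal_mult powr_add)
    then have "ennreal (V z powr \<eta>) * g z = epowr (ennreal (V z) * epowr (g z) p) \<eta> * epowr (g z) (p / r)"
      using \<eta> p by (simp add: epowr_mult epowr_epowr epowr_ennreal mult.assoc)
    also have "z \<in> cone x \<longrightarrow> \<dots> \<le> epowr (\<integral>\<^sup>+x. epowr (ess_area g x) p \<partial>M) \<eta> * epowr (ess_area g x) (p / r)"
      using * \<eta> p r by (auto intro!: mult_mono epowr_mono)
    finally show "z \<in> cone x \<longrightarrow> ennreal (V z powr \<eta>) * g z \<le>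
      epowr (\<integral>\<^sup>+x. epowr (ess_area g x) p \<partial>M) \<eta> * epowr (ess_area g x) (p / r)" .
  qed
  then show ?thesis
    unfolding \<eta>_def by (simp add: ess_sup_on_le_iff)
qed

subsection \<open>Embeddings of tent spaces\<close>

lemma Vf_eq: "Vf M s1 f z = V z powr (s0 - s1) * Vf M s0 f z"
  by (simp add: Vf_def mult.assoc flip: powr_add)

lemma Vf_nonneg [simp]: "0 \<le> Vf M s f z"
  by (simp add: Vf_def)

lemma measurable_Vf [measurable]:
  assumes [measurable]: "f \<in> borel_measurable \<nu>"
  shows "Vf M s f \<in> borel_measurable \<nu>"
  unfolding Vf_def by measurable

text \<open>A change of the weight s becomes the multiplication of k by a power of V, the operation
  studied for cone integrals.\<close>

lemma Vf_powr_eq: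
  "ennreal (Vf M s1 f z powr q) = ennreal (V z powr (q * (s0 - s1))) * ennreal (Vf M s0 f z powr q)"
  by (subst Vf_eq[of s1 f z s0]) (simp add: powr_mult powr_powr mult.commute flip: ennreal_mult)

lemma area_eq:
  "area M (ereal q) s f x = epowr (cone_integral (\<lambda>z. ennreal (Vf M s f z powr q)) x) (1 / q)"
  by (simp add: area_def cone_integral_def flip: ennreal_mult)

lemma area_infinity: "area M \<infinity> s f = ess_area (\<lambda>z. ennreal (Vf M s f z))"
  by (rule ext) (simp add: area_def)

lemma tent_norm_ereal:
  assumes "0 < p" "0 < q"
  shows "tent_norm M (ereal p) (ereal q) s f =
    epowr (\<integral>\<^sup>+x. epowr (cone_integral (\<lambda>z. ennreal (Vf M s f z powr q)) x) (p / q) \<partial>M) (1 / p)"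
  using assms by (simp add: tent_norm_def area_eq epowr_epowr)

lemma tent_norm_ereal_infinity:
  "tent_norm M (ereal p) \<infinity> s f =
    epowr (\<integral>\<^sup>+x. epowr (ess_area (\<lambda>z. ennreal (Vf M s f z)) x) p \<partial>M) (1 / p)"
  by (simp add: tent_norm_def area_infinity)

lemma tent_norm_embedding_ereal:
  assumes p: "0 < p0" "p0 < p1" and q: "0 < q" and s: "s0 - s1 = 1 / p0 - 1 / p1"
  obtains C where "0 < C" "\<And>f. f \<in> borel_measurable \<nu> \<Longrightarrow>
    tent_norm M (ereal p1) (ereal q) s1 f \<le> ennreal C * tent_norm M (ereal p0) (ereal q) s0 f"
proof -
  obtain D where D: "0 < D" "\<And>k. k \<in> borel_measurable \<nu> \<Longrightarrow>
    (\<integral>\<^sup>+x. epowr (cone_integral (\<lambda>z. ennreal (V z powr (1 / (p0 / q) - 1 / (p1 / q))) * k z) x) (p1 / q) \<partial>M)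
      \<le> ennreal D * epowr (\<integral>\<^sup>+x. epowr (cone_integral k x) (p0 / q) \<partial>M) (p1 / q / (p0 / q))"
    using nn_integral_cone_integral_Vol_powr_le[of "p0 / q" "p1 / q"] p q by (auto simp: divide_strict_right_mono)
  \<comment> \<open>The relation between weights and exponents, rescaled to the ratios p0/q and
    p1/q.\<close>
  have e: "q * (s0 - s1) = 1 / (p0 / q) - 1 / (p1 / q)" "p1 / q / (p0 / q) = p1 / p0"
    using q by (simp_all add: s right_diff_distrib)
  show thesis
  proof (rule that[of "D powr (1 / p1)"])
    fix f :: "'a \<times> real \<Rightarrow> real" assume [measurable]: "f \<in> borel_measurable \<nu>"
    let ?k = "\<lambda>s z. ennreal (Vf M s f z powr q)"
    have "(\<integral>\<^sup>+x. epowr (cone_integral (?k s1) x) (p1 / q) \<partial>M) \<le>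
        ennreal D * epowr (\<integral>\<^sup>+x. epowr (cone_integral (?k s0) x) (p0 / q) \<partial>M) (p1 / p0)"
      using D(2)[of "?k s0"] unfolding e[symmetric] Vf_powr_eq[of s1 f _ q s0, symmetric] by simp
    then have "epowr (\<integral>\<^sup>+x. epowr (cone_integral (?k s1) x) (p1 / q) \<partial>M) (1 / p1) \<le>
        epowr (ennreal D * epowr (\<integral>\<^sup>+x. epowr (cone_integral (?k s0) x) (p0 / q) \<partial>M) (p1 / p0)) (1 / p1)"
      using p by (intro epowr_mono) auto
    also have "\<dots> = ennreal (D powr (1 / p1)) * epowr (\<integral>\<^sup>+x. epowr (cone_integral (?k s0) x) (p0 / q) \<partial>M) (1 / p0)"
      using p D(1) by (simp add: epowr_mult epowr_epowr epowr_ennreal)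
    finally show "tent_norm M (ereal p1) (ereal q) s1 f \<le>
        ennreal (D powr (1 / p1)) * tent_norm M (ereal p0) (ereal q) s0 f"
      using p q by (simp add: tent_norm_ereal)
  qed (use D in simp)
qed

text \<open>The pointwise bound to the power p1 is integrated, and X^(\<eta> p1) * X = X^(p1/p0). No
  constant is lost.\<close>

lemma tent_norm_embedding_ereal_infinity:
  assumes p: "0 < p0" "p0 < p1" and s: "s0 - s1 = 1 / p0 - 1 / p1"
    and f[measurable]: "f \<in> borel_measurable \<nu>"
  shows "tent_norm M (ereal p1) \<infinity> s1 f \<le> tent_norm M (ereal p0) \<infinity> s0 f"
proof -
  let ?g = "\<lambda>s z. ennreal (Vf M s f z)"
  define X where "X = (\<integral>\<^sup>+x. epowr (ess_area (?g s0) x) p0 \<partial>M)"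
  define \<eta> where "\<eta> = 1 / p0 - 1 / p1"
  have \<eta>: "0 < \<eta>" using p by (simp add: \<eta>_def frac_less2)
  have g1: "?g s1 = (\<lambda>z. ennreal (V z powr \<eta>) * ?g s0 z)"
    by (rule ext) (simp add: Vf_eq[of s1 f _ s0] s \<eta>_def ennreal_mult)
  have "(\<integral>\<^sup>+x. epowr (ess_area (?g s1) x) p1 \<partial>M) \<le> (\<integral>\<^sup>+x. epowr X (\<eta> * p1) * epowr (ess_area (?g s0) x) p0 \<partial>M)"
  proof (rule nn_integral_mono)
    fix x
    have "ess_area (?g s1) x \<le> epowr X \<eta> * epowr (ess_area (?g s0) x) (p0 / p1)"
      unfolding g1 X_def \<eta>_def using p by (intro ess_area_Vol_powr_le) auto
    then have "epowr (ess_area (?g s1) x) p1 \<le> epowr (epowr X \<eta> * epowr (ess_area (?g s0) x) (p0 / p1)) p1"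
      using p by (intro epowr_mono) auto
    also have "\<dots> = epowr X (\<eta> * p1) * epowr (ess_area (?g s0) x) p0"
      using p \<eta> by (simp add: epowr_mult epowr_epowr)
    finally show "epowr (ess_area (?g s1) x) p1 \<le> \<dots>" .
  qed
  also have "\<dots> = epowr X (\<eta> * p1) * X"
    unfolding X_def by (intro nn_integral_cmult) measurable
  also have "\<dots> = epowr X (p1 / p0)"
  proof (cases X)
    case (real a)
    have "\<eta> * p1 + 1 = p1 / p0" using p by (simp add: \<eta>_def left_diff_distrib)
    then have "a powr (\<eta> * p1) * a powr 1 = a powr (p1 / p0)" by (simp only: flip: powr_add)
    then show ?thesis using real by (simp add: epowr_ennreal flip: ennreal_mult)
  qed simp
  finally have "epowr (\<integral>\<^sup>+x. epowr (ess_area (?g s1) x) p1 \<partial>M) (1 / p1) \<le> epowr (epowr X (p1 / p0)) (1 / p1)"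
    using p by (intro epowr_mono) auto
  also have "\<dots> = epowr X (1 / p0)" using p by (simp add: epowr_epowr)
  finally show ?thesis by (simp add: tent_norm_ereal_infinity X_def)
qed

lemma Vol_le_measure_ball: "ball y t \<subseteq> ball c \<rho> \<Longrightarrow> Vol M y t \<le> measure M (ball c \<rho>)"
  using emeasure_mono[of "ball y t" "ball c \<rho>" M] by (simp add: emeasure_ball flip: Vol_def)

text \<open>The Carleson-type bound with \<open>U\<close> the ball itself; its measure cancels
  against the normalising factor of the norm.\<close>

lemma tent_inf_norm_embedding_ereal:
  assumes p: "0 < p" and q: "0 < q" and s: "s0 - s1 = 1 / p"
  obtains C where "0 < C" "\<And>f. f \<in> borel_measurable \<nu> \<Longrightarrow>
    tent_inf_norm M (ereal q) s1 0 f \<le> ennreal C * tent_norm M (ereal p) (ereal q) s0 f"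
proof (rule that[of "(2 * 2 powr (q / p)) powr (1 / q)"])
  fix f :: "'a \<times> real \<Rightarrow> real" assume [measurable]: "f \<in> borel_measurable \<nu>"
  let ?k = "\<lambda>s z. ennreal (Vf M s f z powr q)"
  define X where "X = (\<integral>\<^sup>+x. epowr (cone_integral (?k s0) x) (p / q) \<partial>M)"
  define K where "K = 2 * 2 powr (q / p)"
  have "ennreal (measure M (ball c \<rho>) powr (- 1 / q)) * tent_Lnorm M (ereal q) s1 f (ball c \<rho>) \<le>
      ennreal (K powr (1 / q)) * epowr X (1 / p)" if \<rho>: "0 < \<rho>" for c \<rho>
  proof -
    define m where "m = Vol M c \<rho>"
    have m: "0 < m" using \<rho> by (simp add: m_def Vol_pos)
    have "(\<integral>\<^sup>+z. indicator (tent (ball c \<rho>)) z * ?k s1 z \<partial>\<nu>) \<le> ennreal (K * m) * epowr X (q / p)"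
    proof (rule le_epowr_of_bound)
      fix I :: real assume I: "0 < I" and A: "X \<le> ennreal I"
      have "q * (s0 - s1) = 1 / (p / q)" by (simp add: s)
      then have "(\<integral>\<^sup>+z. indicator (tent (ball c \<rho>)) z * ?k s1 z \<partial>\<nu>) =
          (\<integral>\<^sup>+z. indicator (tent (ball c \<rho>)) z * (ennreal (V z powr (1 / (p / q))) * ?k s0 z) \<partial>\<nu>)"
        by (subst Vf_powr_eq[of s1 f _ q s0]) simp
      also have "\<dots> \<le> ennreal (2 * (2 * I) powr (1 / (p / q))) * emeasure M (ball c \<rho>)"
        using p q I A unfolding X_def
        by (intro nn_integral_Vol_powr_le) (auto simp: tent_def)
      also have "\<dots> = ennreal (K * m * I powr (q / p))"
        using I by (simp add: emeasure_ball m_def K_def powr_mult mult_ac flip: ennreal_mult)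
      finally show "(\<integral>\<^sup>+z. indicator (tent (ball c \<rho>)) z * ?k s1 z \<partial>\<nu>) \<le> ennreal (K * m * I powr (q / p))" .
    qed (use p q m in \<open>auto simp: K_def\<close>)
    then have "tent_Lnorm M (ereal q) s1 f (ball c \<rho>) \<le> epowr (ennreal (K * m) * epowr X (q / p)) (1 / q)"
      using q by (auto simp: tent_Lnorm_def intro!: epowr_mono)
    also have "\<dots> = ennreal ((K * m) powr (1 / q)) * epowr X (1 / p)"
      using p q m by (simp add: epowr_mult epowr_epowr epowr_ennreal K_def)
    finally have "ennreal (m powr (- 1 / q)) * tent_Lnorm M (ereal q) s1 f (ball c \<rho>) \<le>
        ennreal (m powr (- 1 / q)) * (ennreal ((K * m) powr (1 / q)) * epowr X (1 / p))"
      by (rule mult_left_mono) simp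
    also have "\<dots> = ennreal (m powr (- 1 / q) * (K * m) powr (1 / q)) * epowr X (1 / p)"
      by (simp add: ennreal_mult mult.assoc)
    also have "m powr (- 1 / q) * (K * m) powr (1 / q) = K powr (1 / q)"
      using m by (simp add: K_def powr_mult powr_minus_divide)
    finally show ?thesis by (simp add: m_def Vol_def)
  qed
  then show "tent_inf_norm M (ereal q) s1 0 f \<le>
      ennreal ((2 * 2 powr (q / p)) powr (1 / q)) * tent_norm M (ereal p) (ereal q) s0 f"
    using p q unfolding tent_inf_norm_def
    by (intro SUP_least) (auto simp: tent_norm_ereal inv_exp_def X_def K_def)
qed simp

text \<open>The bound on V^(1/p) g holds almost everywhere on the whole half-space, hence on every
  tent.\<close>

lemma tent_inf_norm_embedding_infinity:
  assumes p: "0 < p" and s: "s0 - s1 = 1 / p" and f[measurable]: "f \<in> borel_measurable \<nu>"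
  shows "tent_inf_norm M \<infinity> s1 0 f \<le> tent_norm M (ereal p) \<infinity> s0 f"
proof -
  let ?N = "tent_norm M (ereal p) \<infinity> s0 f"
  have "AE z in \<nu>. ennreal (Vf M s1 f z) \<le> ?N"
    using AE_Vol_powr_mult_le[of "\<lambda>z. ennreal (Vf M s0 f z)" p] p s
    by (simp add: Vf_eq[of s1 f _ s0] tent_norm_ereal_infinity ennreal_mult)
  then have "tent_Lnorm M \<infinity> s1 f B \<le> ?N" for B
    by (auto simp: tent_Lnorm_def ess_sup_on_le_iff)
  \<comment> \<open>The normalising factor has exponent 0; \<open>powr\<close> gives 0 at base 0 and
    1 elsewhere.\<close>
  moreover have "ennreal (a powr 0) * b \<le> b" for a :: real and b :: ennreal
    by (cases "a = 0") auto
  ultimately show ?thesis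
    unfolding tent_inf_norm_def by (auto intro!: SUP_least simp: inv_exp_def intro: order.trans)
qed

text \<open>On the tent over B one has V \<le> mu(B), so the weight V^\<alpha> gained by passing to
  s + \<alpha> is absorbed by the factor mu(B)^(-\<alpha>).\<close>

lemma tent_inf_norm_shift:
  assumes q: "0 < q" and \<alpha>: "0 \<le> \<alpha>"
  shows "tent_inf_norm M (ereal q) s \<alpha> f \<le> tent_inf_norm M (ereal q) (s + \<alpha>) 0 f"
  unfolding tent_inf_norm_def
proof (intro SUP_mono)
  fix B :: "'a set" assume B: "B \<in> {ball c \<rho> |c \<rho>. 0 < \<rho>}"
  then obtain c \<rho> where B': "B = ball c \<rho>" "0 < \<rho>" by blast
  define m where "m = measure M B"
  have m: "0 < m" using Vol_pos[OF B'(2), of c] by (simp add: m_def B' Vol_def)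
  let ?J = "\<lambda>s. \<integral>\<^sup>+z. indicator (tent B) z * ennreal (Vf M s f z powr q) \<partial>\<nu>"
  have "indicator (tent B) z * ennreal (Vf M s f z powr q) \<le>
      ennreal (m powr (q * \<alpha>)) * (indicator (tent B) z * ennreal (Vf M (s + \<alpha>) f z powr q))" for z
  proof (cases "z \<in> tent B")
    case True
    then have "V z \<le> m"
      using Vol_le_measure_ball by (auto simp: tent_def m_def B')
    then have "ennreal (V z powr (q * \<alpha>)) \<le> ennreal (m powr (q * \<alpha>))"
      using q \<alpha> by (intro ennreal_leI powr_mono2) auto
    then show ?thesis
      using Vf_powr_eq[of s f z q "s + \<alpha>"] True by (simp add: mult_right_mono)
  qed auto
  then have "?J s \<le> (\<integral>\<^sup>+z. ennreal (m powr (q * \<alpha>)) * (indicator (tent B) z * ennreal (Vf M (s + \<alpha>) f z powr q)) \<partial>\<nu>)"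
    by (rule nn_integral_mono)
  also have "\<dots> \<le> ennreal (m powr (q * \<alpha>)) * ?J (s + \<alpha>)"
    using m by (intro nn_integral_cmult_le) simp
  finally have "tent_Lnorm M (ereal q) s f B \<le> epowr (ennreal (m powr (q * \<alpha>)) * ?J (s + \<alpha>)) (1 / q)"
    using q by (auto simp: tent_Lnorm_def intro!: epowr_mono)
  also have "\<dots> = ennreal (m powr \<alpha>) * tent_Lnorm M (ereal q) (s + \<alpha>) f B"
    using q m by (simp add: tent_Lnorm_def epowr_mult epowr_ennreal powr_powr)
  finally have "ennreal (m powr (- \<alpha> - 1 / q)) * tent_Lnorm M (ereal q) s f B \<le>
      ennreal (m powr (- \<alpha> - 1 / q)) * (ennreal (m powr \<alpha>) * tent_Lnorm M (ereal q) (s + \<alpha>) f B)"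
    by (rule mult_left_mono) simp
  also have "\<dots> = ennreal (m powr (- 0 - 1 / q)) * tent_Lnorm M (ereal q) (s + \<alpha>) f B"
  proof -
    have "m powr (- \<alpha> - 1 / q) * m powr \<alpha> = m powr (- 0 - 1 / q)"
      by (simp flip: powr_add)
    then show ?thesis by (simp flip: mult.assoc ennreal_mult)
  qed
  finally show "\<exists>B'\<in>{ball c \<rho> |c \<rho>. 0 < \<rho>}. ennreal (measure M B powr (- \<alpha> - inv_exp (ereal q))) * tent_Lnorm M (ereal q) s f B
      \<le> ennreal (measure M B' powr (- 0 - inv_exp (ereal q))) * tent_Lnorm M (ereal q) (s + \<alpha>) f B'"
    using B by (intro bexI[of _ B]) (auto simp: inv_exp_def m_def)
qed

end

section \<open>Both embeddings, by cases on which exponents are infinite\<close>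

theorem mainTheorem18:
  fixes M :: "'a::metric_space measure"
  assumes X: "doubling_mms M"
  shows
    "(\<forall>(p0::ereal) p1 (q::ereal) (s0::real) s1.
        0 < p0 \<and> p0 < p1 \<and> p1 \<le> \<infinity> \<and> 0 < q \<and> q \<le> \<infinity> \<and> s0 > s1 \<and>
        s1 - s0 = delta_exp p0 p1 \<longrightarrow>
        (\<exists>C::real. 0 < C \<and> (\<forall>f \<in> borel_measurable (Xplus M).
            tent_norm M p1 q s1 f \<le> ennreal C * tent_norm M p0 q s0 f)))
   \<and> (\<forall>(p0::ereal) (q::ereal) (\<alpha>::real) (s0::real) s1.
        0 < p0 \<and> p0 \<le> \<infinity> \<and> 1 < q \<and> q < \<infinity> \<and> 0 < \<alpha> \<and>
        (s1 + \<alpha>) - s0 = delta_exp p0 \<infinity> \<longrightarrow>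
        (\<exists>C::real. 0 < C \<and> (\<forall>f \<in> borel_measurable (Xplus M).
            tent_inf_norm M q s1 \<alpha> f \<le> ennreal C * tent_norm M p0 q s0 f)))"
proof (intro conjI allI impI)
  interpret doubling_space M by standard (rule X)
  fix p0 p1 q :: ereal and s0 s1 :: real
  assume *: "0 < p0 \<and> p0 < p1 \<and> p1 \<le> \<infinity> \<and> 0 < q \<and> q \<le> \<infinity> \<and> s0 > s1 \<and> s1 - s0 = delta_exp p0 p1"
  \<comment> \<open>p0 < p1 forces p0 to be finite.\<close>
  obtain a where a: "p0 = ereal a" "0 < a" using * by (cases p0) auto
  show "\<exists>C::real. 0 < C \<and> (\<forall>f \<in> borel_measurable (Xplus M).
            tent_norm M p1 q s1 f \<le> ennreal C * tent_norm M p0 q s0 f)"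
  proof (cases p1)
    case (real b)
    then have b: "a < b" and s: "s0 - s1 = 1 / a - 1 / b"
      using * a by (auto simp: delta_exp_def inv_exp_def)
    show ?thesis
    proof (cases q)
      case (real c)
      then have "0 < c" using * by simp
      from tent_norm_embedding_ereal[OF a(2) b this s] obtain C where "0 < C"
        "\<And>f. f \<in> borel_measurable (Xplus M) \<Longrightarrow>
          tent_norm M (ereal b) (ereal c) s1 f \<le> ennreal C * tent_norm M (ereal a) (ereal c) s0 f"
        by blast
      then show ?thesis using a \<open>p1 = ereal b\<close> real by blast
    next
      case PInf
      then show ?thesis using tent_norm_embedding_ereal_infinity[OF a(2) b s] a \<open>p1 = ereal b\<close>
        by (intro exI[of _ 1]) auto
    qed (use * in auto)
  next
    case PInf
    then have s: "s0 - s1 = 1 / a"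
      using * a by (auto simp: delta_exp_def inv_exp_def)
    show ?thesis
    proof (cases q)
      case (real c)
      then have "0 < c" using * by simp
      from tent_inf_norm_embedding_ereal[OF a(2) this s] obtain C where "0 < C"
        "\<And>f. f \<in> borel_measurable (Xplus M) \<Longrightarrow>
          tent_inf_norm M (ereal c) s1 0 f \<le> ennreal C * tent_norm M (ereal a) (ereal c) s0 f"
        by blast
      then show ?thesis using a PInf real by (auto simp: tent_norm_def[of M \<infinity>])
    next
      case q: PInf
      then show ?thesis using tent_inf_norm_embedding_infinity[OF a(2) s] a PInf
        by (intro exI[of _ 1]) (auto simp: tent_norm_def[of M \<infinity>])
    qed (use * in auto)
  qed (use * in auto)
next
  interpret doubling_space M by standard (rule X)
  fix p0 q :: ereal and \<alpha> s0 s1 :: real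
  assume *: "0 < p0 \<and> p0 \<le> \<infinity> \<and> 1 < q \<and> q < \<infinity> \<and> 0 < \<alpha> \<and> (s1 + \<alpha>) - s0 = delta_exp p0 \<infinity>"
  obtain c where c: "q = ereal c" "0 < c" using * by (cases q) auto
  \<comment> \<open>Reduces the second embedding to the endpoint norm without \<alpha>, at the
    weight s1 + \<alpha>.\<close>
  have shift: "tent_inf_norm M q s1 \<alpha> f \<le> tent_inf_norm M q (s1 + \<alpha>) 0 f" for f
    using tent_inf_norm_shift[OF c(2), of \<alpha> s1 f] * c(1) by simp
  show "\<exists>C::real. 0 < C \<and> (\<forall>f \<in> borel_measurable (Xplus M).
            tent_inf_norm M q s1 \<alpha> f \<le> ennreal C * tent_norm M p0 q s0 f)"
  proof (cases p0)
    case (real a)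
    then have a: "0 < a" and s: "s0 - (s1 + \<alpha>) = 1 / a"
      using * by (auto simp: delta_exp_def inv_exp_def)
    from tent_inf_norm_embedding_ereal[OF a c(2) s] obtain C where "0 < C"
      "\<And>f. f \<in> borel_measurable (Xplus M) \<Longrightarrow>
        tent_inf_norm M (ereal c) (s1 + \<alpha>) 0 f \<le> ennreal C * tent_norm M (ereal a) (ereal c) s0 f"
      by blast
    then show ?thesis using c real shift by (blast intro: order.trans)
  next
    case PInf
    \<comment> \<open>For p0 = \<infinity> the difference of the exponents is 0, so the shift alone
      is the embedding.\<close>
    then have "s1 + \<alpha> = s0" using * by (simp add: delta_exp_def)
    then show ?thesis using shift PInf by (intro exI[of _ 1]) (auto simp: tent_norm_def)
  qed (use * in auto)
qed

end
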